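(* For every DG algebra $R\in\mathtt{DGA}_k$ and every integer $n\ge 1$, the homomorphism of graded commutative algebras $$\boldsymbol\Lambda\mathrm{Tr}_n(R)_\bullet:\ \boldsymbol\Lambda(R_\natural)\to R_n^{\mathrm{GL}}$$ is surjective in every homological degree.
   Context: $k$ is a field of characteristic $0$. All DG objects are $\mathbb Z$-graded with differential of degree $-1$, and the Koszul sign rule is used. $\mathtt{DGA}_k$ (resp. $\mathtt{CDGA}_k$) denotes the category of (resp. graded-commutative) unital DG $k$-algebras. For $A\in\mathtt{DGA}_k$ and $n\ge1$, $A_n\in\mathtt{CDGA}_k$ denotes the commutative DG algebra representing the functor $\mathtt{CDGA}_k\to\mathtt{Sets}$, $B\mapsto \mathrm{Hom}_{\mathtt{DGA}_k}(A,\mathbb M_n(B))$ (explicitly, $A_n$ is the maximal graded-commutative quotient of the graded centralizer of $\mathbb M_n(k)$ in the free product $A*_k\mathbb M_n(k)$); $\pi_n:A\to\mathbb M_n(A_n)$ is the universal representation. The group $\mathrm{GL}_n(k)$ acts on $A_n$ by DG algebra automorphisms: $g$ acts by the automorphism corresponding to $\mathrm{Ad}(g)\circ\pi_n$; $A_n^{\mathrm{GL}}$ denotes the invariant subalgebra. For a DG algebra $R$, $R_\natural:=R/[R,R]$, where $[R,R]$ is the subcomplex spanned by graded commutators. The composite $R\xrightarrow{\pi_n}\mathbb M_n(R_n)\xrightarrow{\mathrm{Tr}}R_n$ factors through a chain map $\mathrm{Tr}_n(R)_\bullet:R_\natural\to R_n^{\mathrm{GL}}$. $\boldsymbol\Lambda(V)$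 denotes the graded symmetric algebra of a graded vector space (symmetric on even, exterior on odd part), and $\boldsymbol\Lambda\mathrm{Tr}_n(R)_\bullet$ is the unique algebra map extending $\mathrm{Tr}_n(R)_\bullet$. *)

theory Defs
  imports Main
begin

definition ksign :: "int \<Rightarrow> int \<Rightarrow> 'k::comm_ring_1" where
  "ksign a b = (if even (a * b) then 1 else - 1)"

definition is_dga :: "('k::field \<Rightarrow> 'r::ring_1 \<Rightarrow> 'r) \<Rightarrow> (int \<Rightarrow> 'r set) \<Rightarrow> ('r \<Rightarrow> 'r) \<Rightarrow> bool" where
  "is_dga smul G d \<longleftrightarrow>
     (\<forall>c x y. smul c (x + y) = smul c x + smul c y) \<and>
     (\<forall>c e x. smul (c + e) x = smul c x + smul e x) \<and>
     (\<forall>c e x. smul (c * e) x = smul c (smul e x)) \<and>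
     (\<forall>x. smul 1 x = x) \<and>
     (\<forall>c x y. smul c (x * y) = smul c x * y \<and> smul c (x * y) = x * smul c y) \<and>
     (\<forall>i. 0 \<in> G i \<and> (\<forall>x\<in>G i. \<forall>y\<in>G i. x + y \<in> G i) \<and> (\<forall>c. \<forall>x\<in>G i. smul c x \<in> G i)) \<and>
     (\<forall>x. \<exists>!f :: int \<Rightarrow> 'r. finite {i. f i \<noteq> 0} \<and> (\<forall>i. f i \<in> G i) \<and> x = sum f {i. f i \<noteq> 0}) \<and>
     (\<forall>i j. \<forall>x\<in>G i. \<forall>y\<in>G j. x * y \<in> G (i + j)) \<and>
     1 \<in> G 0 \<and>
     (\<forall>x y. d (x + y) = d x + d y) \<and> (\<forall>c x. d (smul c x) = smul c (d x)) \<and>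
     (\<forall>i. \<forall>x\<in>G i. d x \<in> G (i - 1)) \<and>
     (\<forall>x. d (d x) = 0) \<and>
     (\<forall>i. \<forall>x\<in>G i. \<forall>y. d (x * y) = d x * y + smul (ksign 1 i) (x * d y))"

text \<open>A noncommutative polynomial in variables of type 'x is a finitely supported
function from words ('x list) to k.\<close>

type_synonym ('x, 'k) ncpoly = "'x list \<Rightarrow> 'k"

definition npzero :: "('x, 'k::comm_ring_1) ncpoly" where "npzero = (\<lambda>w. 0)"
definition npone :: "('x, 'k::comm_ring_1) ncpoly" where "npone = (\<lambda>w. if w = [] then 1 else 0)"
definition npvar :: "'x \<Rightarrow> ('x, 'k::comm_ring_1) ncpoly" where "npvar x = (\<lambda>w. if w = [x] then 1 else 0)"
definition npadd :: "('x, 'k::comm_ring_1) ncpoly \<Rightarrow> ('x, 'k) ncpoly \<Rightarrow> ('x, 'k) ncpoly" where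
  "npadd p q = (\<lambda>w. p w + q w)"
definition npsub :: "('x, 'k::comm_ring_1) ncpoly \<Rightarrow> ('x, 'k) ncpoly \<Rightarrow> ('x, 'k) ncpoly" where
  "npsub p q = (\<lambda>w. p w - q w)"
definition npscale :: "'k::comm_ring_1 \<Rightarrow> ('x, 'k) ncpoly \<Rightarrow> ('x, 'k) ncpoly" where
  "npscale c p = (\<lambda>w. c * p w)"
definition npmul :: "('x, 'k::comm_ring_1) ncpoly \<Rightarrow> ('x, 'k) ncpoly \<Rightarrow> ('x, 'k) ncpoly" where
  "npmul p q = (\<lambda>w. \<Sum>i\<le>length w. p (take i w) * q (drop i w))"
definition npprod :: "('x, 'k::comm_ring_1) ncpoly list \<Rightarrow> ('x, 'k) ncpoly" where
  "npprod ps = foldr npmul ps npone"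
definition npsum :: "('a \<Rightarrow> ('x, 'k::comm_ring_1) ncpoly) \<Rightarrow> 'a set \<Rightarrow> ('x, 'k) ncpoly" where
  "npsum f A = (\<lambda>w. \<Sum>a\<in>A. f a w)"

definition npPol :: "('x \<Rightarrow> bool) \<Rightarrow> ('x, 'k::comm_ring_1) ncpoly set" where
  "npPol V = {p. finite {w. p w \<noteq> 0} \<and> (\<forall>w. p w \<noteq> 0 \<longrightarrow> (\<forall>x\<in>set w. V x))}"

definition npsubst :: "('x \<Rightarrow> ('x, 'k::comm_ring_1) ncpoly) \<Rightarrow> ('x, 'k) ncpoly \<Rightarrow> ('x, 'k) ncpoly" where
  "npsubst \<sigma> p = (\<lambda>w. \<Sum>u\<in>{u. p u \<noteq> 0}. p u * npprod (map \<sigma> u) w)"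

inductive_set np_ideal :: "('x \<Rightarrow> bool) \<Rightarrow> ('x, 'k::comm_ring_1) ncpoly set \<Rightarrow> ('x, 'k) ncpoly set"
  for V S where
    base: "s \<in> S \<Longrightarrow> s \<in> np_ideal V S"
  | zero: "npzero \<in> np_ideal V S"
  | add: "a \<in> np_ideal V S \<Longrightarrow> b \<in> np_ideal V S \<Longrightarrow> npadd a b \<in> np_ideal V S"
  | lmul: "a \<in> np_ideal V S \<Longrightarrow> q \<in> npPol V \<Longrightarrow> npmul q a \<in> np_ideal V S"
  | rmul: "a \<in> np_ideal V S \<Longrightarrow> q \<in> npPol V \<Longrightarrow> npmul a q \<in> np_ideal V S"

text \<open>Generators of R_n: symbols (m, r, i, j) standing for the (i,j) matrix entry of
pi_n(r), for r homogeneous of degree m and i, j < n; its degree is m.\<close>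

type_synonym 'r rgen = "int \<times> 'r \<times> nat \<times> nat"

definition rvalid :: "(int \<Rightarrow> 'r set) \<Rightarrow> nat \<Rightarrow> 'r rgen \<Rightarrow> bool" where
  "rvalid G n x = (case x of (m, r, i, j) \<Rightarrow> r \<in> G m \<and> i < n \<and> j < n)"

definition rdeg :: "'r rgen \<Rightarrow> int" where
  "rdeg x = fst x"

text \<open>Defining relations of R_n: linearity in r (on each homogeneous component),
multiplicativity pi(r s) = pi(r) pi(s), unitality pi(1) = identity matrix, and
graded commutativity of the generators (Koszul sign).\<close>
definition Rn_rels :: "('k::field_char_0 \<Rightarrow> 'r::ring_1 \<Rightarrow> 'r) \<Rightarrow> (int \<Rightarrow> 'r set) \<Rightarrow> nat \<Rightarrow> ('r rgen, 'k) ncpoly set" where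
  "Rn_rels smul G n =
     {npsub (npvar (m, smul c r + s, i, j)) (npadd (npscale c (npvar (m, r, i, j))) (npvar (m, s, i, j)))
       | m c r s i j. r \<in> G m \<and> s \<in> G m \<and> i < n \<and> j < n}
   \<union> {npsub (npvar (a + b, r * s, i, j)) (npsum (\<lambda>l. npmul (npvar (a, r, i, l)) (npvar (b, s, l, j))) {..<n})
       | a b r s i j. r \<in> G a \<and> s \<in> G b \<and> i < n \<and> j < n}
   \<union> {npsub (npvar (0, 1, i, j)) (if i = j then npone else npzero) | i j. i < n \<and> j < n}
   \<union> {npsub (npmul (npvar x) (npvar y)) (npscale (ksign (rdeg x) (rdeg y)) (npmul (npvar y) (npvar x)))
       | x y. rvalid G n x \<and> rvalid G n y}"

definition Rn_ideal :: "('k::field_char_0 \<Rightarrow> 'r::ring_1 \<Rightarrow> 'r) \<Rightarrow> (int \<Rightarrow> 'r set) \<Rightarrow> nat \<Rightarrow> ('r rgen, 'k) ncpoly set" where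
  "Rn_ideal smul G n = np_ideal (rvalid G n) (Rn_rels smul G n)"

definition nphomog :: "int \<Rightarrow> ('r rgen, 'k::comm_ring_1) ncpoly \<Rightarrow> bool" where
  "nphomog m p \<longleftrightarrow> (\<forall>w. p w \<noteq> 0 \<longrightarrow> sum_list (map rdeg w) = m)"

definition inv_pair :: "nat \<Rightarrow> (nat \<Rightarrow> nat \<Rightarrow> 'k::field) \<Rightarrow> (nat \<Rightarrow> nat \<Rightarrow> 'k) \<Rightarrow> bool" where
  "inv_pair n g h \<longleftrightarrow>
     (\<forall>i<n. \<forall>j<n. (\<Sum>l<n. g i l * h l j) = (if i = j then 1 else 0)
                \<and> (\<Sum>l<n. h i l * g l j) = (if i = j then 1 else 0))"

text \<open>g (with inverse h) acts by the automorphism corresponding to Ad(g) o pi_n: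
the generator (m,r,i,j) goes to the (i,j) entry of g pi_n(r) g^-1.\<close>
definition glact :: "nat \<Rightarrow> (nat \<Rightarrow> nat \<Rightarrow> 'k::field) \<Rightarrow> (nat \<Rightarrow> nat \<Rightarrow> 'k) \<Rightarrow> 'r rgen \<Rightarrow> ('r rgen, 'k) ncpoly" where
  "glact n g h x = (case x of (m, r, i, j) \<Rightarrow>
      npsum (\<lambda>(a, b). npscale (g i a * h b j) (npvar (m, r, a, b))) ({..<n} \<times> {..<n}))"

definition nptr :: "nat \<Rightarrow> int \<Rightarrow> 'r \<Rightarrow> ('r rgen, 'k::comm_ring_1) ncpoly" where
  "nptr n m r = npsum (\<lambda>i. npvar (m, r, i, i)) {..<n}"

definition trprod :: "nat \<Rightarrow> (int \<times> 'r) list \<Rightarrow> ('r rgen, 'k::comm_ring_1) ncpoly" where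
  "trprod n ls = npprod (map (\<lambda>(m, r). nptr n m r) ls)"

text \<open>Degree m part of the image of Lambda Tr_n: k-linear combinations of products
Tr(r_1) ... Tr(r_s) of traces of homogeneous elements with total degree m
(the empty product being 1).\<close>
inductive_set trace_span :: "(int \<Rightarrow> 'r set) \<Rightarrow> nat \<Rightarrow> int \<Rightarrow> ('r rgen, 'k::comm_ring_1) ncpoly set"
  for G n m where
    zero: "npzero \<in> trace_span G n m"
  | step: "(\<forall>(a, r)\<in>set ls. r \<in> G a) \<Longrightarrow> sum_list (map fst ls) = m \<Longrightarrow> q \<in> trace_span G n m
           \<Longrightarrow> npadd (npscale c (trprod n ls)) q \<in> trace_span G n m"

end

(* Let F(g) be the sum of p_u * det(g)^M * (g . u) over the words u of p, where g^-1 is written as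
   adj(g) / det(g); padding the words to the common length M by entries of pi(1) = 1 lets the
   denominators cancel uniformly and makes F polynomial in g.
   Invariance gives F(g) = det(g)^M p modulo the relations, for every matrix g. Polarizing both sides
   and contracting with the alternating coefficients of det^M (an apolar form of Cayley's Omega
   process) turns the right-hand side into a nonzero multiple of p: the multiple is a sum of squares
   up to a positive factor. On the left, two alternating tensors meet in each block, and their product
   is a signed sum of index contractions; contracted words of matrix entries are products of traces
   because pi is multiplicative. This gives linear reductivity of GL_n and the first fundamental
   theorem in one computation. *)

theory Submission
  imports
    Defs
    "HOL-Library.FuncSet"
    "HOL-Library.Function_Algebras"
    "HOL-Combinatorics.Permutations"
    "Jordan_Normal_Form.Determinant"
begin

text \<open>Invariance modulo the relations speaks about one matrix g at a time, so coefficients in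
  g cannot simply be compared. Polarization recovers them from finitely many values of g, namely at
  sums of elementary matrices. These include singular matrices such as 0, which is why the identity
  for F is needed for all g. Since every word is padded to length M, both sides have degree n M in
  g, one entry of g for each slot (t, s) with t < M and s < n. Of the two alternating tensors on the
  left, one is the Leibniz expansion of the adjugates, the other the coefficient tensor of the
  contraction. A letter uses just one index of each; polarization forces the remaining ones to match
  in pairs. These matchings are written as entries of pi(1), so that every index occurs in a letter:
  those of one tensor once as a row index, those of the other once as a column index. After
  contraction each label occurs exactly once in each position, the shape that multiplicativity of pi
  collapses to traces. Koszul signs depend on degrees alone, hence are constant on each sum over
  matrix indices.\<close>

subsection \<open>Sums over function spaces and polarization\<close>

lemma sum_PiE_insert:
  assumes "a \<notin> A"
  shows "(\<Sum>f\<in>Pi\<^sub>E (insert a A) B. F f) = (\<Sum>z\<in>B a. \<Sum>f\<in>Pi\<^sub>E A B. F (f(a := z)))"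
  using inj_combinator[OF assms, of B]
  by (simp add: PiE_insert_eq sum.reindex sum.cartesian_product case_prod_unfold)

lemma sum_PiE_Times:
  "(\<Sum>\<zeta>\<in>Pi\<^sub>E A (\<lambda>_. B \<times> C). F \<zeta>) =
   (\<Sum>a\<in>Pi\<^sub>E A (\<lambda>_. B). \<Sum>c\<in>Pi\<^sub>E A (\<lambda>_. C). F (\<lambda>t\<in>A. (a t, c t)))"
proof -
  have "(\<Sum>\<zeta>\<in>Pi\<^sub>E A (\<lambda>_. B \<times> C). F \<zeta>) =
      (\<Sum>z\<in>Pi\<^sub>E A (\<lambda>_. B) \<times> Pi\<^sub>E A (\<lambda>_. C). F (\<lambda>t\<in>A. (fst z t, snd z t)))"
    by (rule sum.reindex_bij_witness[where
          j = "\<lambda>\<zeta>. (\<lambda>t\<in>A. fst (\<zeta> t), \<lambda>t\<in>A. snd (\<zeta> t))" and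
          i = "\<lambda>z. \<lambda>t\<in>A. (fst z t, snd z t)"])
      (auto simp: PiE_iff extensional_def fun_eq_iff mem_Times_iff intro!: arg_cong[of _ _ F])
  then show ?thesis by (simp add: sum.cartesian_product case_prod_unfold)
qed

lemma sum_PiE_delta:
  assumes "finite A" "\<And>t. t \<in> A \<Longrightarrow> x t \<in> B" "finite B"
  shows "(\<Sum>a\<in>Pi\<^sub>E A (\<lambda>_. B). if \<forall>t\<in>A. a t = x t then F a else 0) = F (restrict x A)"
proof -
  have "(\<Sum>a\<in>Pi\<^sub>E A (\<lambda>_. B). if \<forall>t\<in>A. a t = x t then F a else 0)
      = (\<Sum>a\<in>Pi\<^sub>E A (\<lambda>_. B). if a = restrict x A then F a else 0)"
    by (rule sum.cong) (auto simp: PiE_iff extensional_def fun_eq_iff)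
  also have "\<dots> = F (restrict x A)"
    using assms by (subst sum.delta) (auto intro!: finite_PiE)
  finally show ?thesis .
qed

lemma sum_Pow_neg_one:
  assumes "finite U"
  shows "(\<Sum>T\<in>Pow U. (- 1) ^ card T) = (if U = {} then 1 else 0 :: 'a::comm_ring_1)"
  using assms
proof induction
  case (insert u U)
  have "(\<Sum>T\<in>insert u ` Pow U. (- 1) ^ card T) = (\<Sum>T\<in>Pow U. (- 1) ^ card (insert u T) :: 'a)"
    using insert.hyps by (subst sum.reindex) (auto simp: inj_on_def)
  also have "\<dots> = (\<Sum>T\<in>Pow U. - ((- 1) ^ card T))"
  proof (intro sum.cong refl)
    fix T assume "T \<in> Pow U"
    then have "finite T" "u \<notin> T" using insert.hyps by (auto intro: finite_subset)
    then show "(- 1) ^ card (insert u T) = - ((- 1) ^ card T :: 'a)" by simp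
  qed
  finally have "(\<Sum>T\<in>insert u ` Pow U. (- 1) ^ card T) = - (\<Sum>T\<in>Pow U. (- 1) ^ card T :: 'a)"
    by (simp add: sum_negf)
  moreover have "Pow U \<inter> insert u ` Pow U = {}" using insert.hyps by auto
  ultimately show ?case using insert.hyps
    by (simp add: Pow_insert sum.union_disjoint)
qed simp

text \<open>A permutation is the identity outside \<open>Q\<close>, an extensional function is
  undefined there; restriction passes between the two conventions.\<close>

lemma surj_PiE_permutes_bij:
  assumes "finite Q"
  shows "bij_betw (\<lambda>\<pi>. restrict \<pi> Q) {\<pi>. \<pi> permutes Q} {f \<in> Pi\<^sub>E Q (\<lambda>_. Q). f ` Q = Q}"
proof (rule bij_betwI')
  fix p r assume "p \<in> {\<pi>. \<pi> permutes Q}" "r \<in> {\<pi>. \<pi> permutes Q}"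
  then show "restrict p Q = restrict r Q \<longleftrightarrow> p = r"
    by (auto simp: restrict_def fun_eq_iff permutes_def) metis
next
  fix p assume "p \<in> {\<pi>. \<pi> permutes Q}"
  then show "restrict p Q \<in> {f \<in> Pi\<^sub>E Q (\<lambda>_. Q). f ` Q = Q}"
    by (auto simp: permutes_in_image permutes_image)
next
  fix f assume f: "f \<in> {f \<in> Pi\<^sub>E Q (\<lambda>_. Q). f ` Q = Q}"
  let ?p = "\<lambda>x. if x \<in> Q then f x else x"
  have "bij_betw f Q Q" using f assms by (auto simp: bij_betw_def finite_surj_inj)
  then have "bij_betw ?p Q Q" by (subst bij_betw_cong[of _ _ f]) auto
  then have "?p permutes Q" by (intro bij_imp_permutes) auto
  moreover have "f = restrict ?p Q" using f by (auto simp: PiE_iff extensional_def fun_eq_iff)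
  ultimately show "\<exists>p\<in>{\<pi>. \<pi> permutes Q}. f = restrict p Q" by blast
qed

text \<open>Ryser's formula for the permanent; it is the polarization identity of
  a product of linear forms.\<close>

lemma permanent_Ryser:
  fixes x :: "'q \<Rightarrow> 'q \<Rightarrow> 'a::comm_ring_1"
  assumes Q: "finite Q"
  shows "(\<Sum>S\<in>Pow Q. (- 1) ^ card (Q - S) * (\<Prod>q\<in>Q. \<Sum>s\<in>S. x s q)) =
    (\<Sum>\<pi> | \<pi> permutes Q. \<Prod>q\<in>Q. x (\<pi> q) q)"
proof -
  have fin: "finite (Pi\<^sub>E Q (\<lambda>_. Q))" using Q by (intro finite_PiE)
  have 1: "(\<Prod>q\<in>Q. \<Sum>s\<in>S. x s q) =
      (\<Sum>f\<in>Pi\<^sub>E Q (\<lambda>_. Q). if f ` Q \<subseteq> S then \<Prod>q\<in>Q. x (f q) q else 0)" if "S \<subseteq> Q" for S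
  proof -
    have "(\<Prod>q\<in>Q. \<Sum>s\<in>S. x s q) = (\<Sum>f\<in>Pi\<^sub>E Q (\<lambda>_. S). \<Prod>q\<in>Q. x (f q) q)"
      using Q that finite_subset by (intro prod_sum_PiE) auto
    also have "\<dots> = (\<Sum>f\<in>{f\<in>Pi\<^sub>E Q (\<lambda>_. Q). f ` Q \<subseteq> S}. \<Prod>q\<in>Q. x (f q) q)"
      using that by (intro sum.cong) auto
    finally show ?thesis using fin by (simp add: sum.If_cases Int_def)
  qed
  \<comment> \<open>Inclusion-exclusion: the complement of \<open>S\<close> runs through the subsets
    of \<open>Q\<close> that avoid the image of \<open>f\<close>, so the signs cancel unless
    \<open>f\<close> is onto.\<close>
  have 2: "(\<Sum>S\<in>Pow Q. if f ` Q \<subseteq> S then (- 1) ^ card (Q - S) else 0) =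
      (if f ` Q = Q then 1 else 0 :: 'a)" if "f \<in> Pi\<^sub>E Q (\<lambda>_. Q)" for f
  proof -
    have sub: "f ` Q \<subseteq> Q" using that by auto
    have "(\<Sum>S\<in>Pow Q. if f ` Q \<subseteq> S then (- 1) ^ card (Q - S) else 0) =
        (\<Sum>S\<in>{S\<in>Pow Q. f ` Q \<subseteq> S}. (- 1) ^ card (Q - S) :: 'a)"
      using Q by (simp add: sum.If_cases Int_def)
    also have "\<dots> = (\<Sum>T\<in>Pow (Q - f ` Q). (- 1) ^ card T)"
      using sub by (intro sum.reindex_bij_witness[where i = "\<lambda>T. Q - T" and j = "\<lambda>S. Q - S"])
        (auto simp: double_diff)
    also have "\<dots> = (if f ` Q = Q then 1 else 0)"
      using Q sub by (subst sum_Pow_neg_one) auto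
    finally show ?thesis .
  qed
  have "(\<Sum>S\<in>Pow Q. (- 1) ^ card (Q - S) * (\<Prod>q\<in>Q. \<Sum>s\<in>S. x s q)) =
      (\<Sum>S\<in>Pow Q. \<Sum>f\<in>Pi\<^sub>E Q (\<lambda>_. Q).
        (if f ` Q \<subseteq> S then (- 1) ^ card (Q - S) else 0) * (\<Prod>q\<in>Q. x (f q) q))"
    by (intro sum.cong refl) (auto simp: 1 sum_distrib_left intro!: sum.cong)
  also have "\<dots> = (\<Sum>f\<in>Pi\<^sub>E Q (\<lambda>_. Q). (if f ` Q = Q then 1 else 0) * (\<Prod>q\<in>Q. x (f q) q))"
    by (subst sum.swap) (simp add: 2 flip: sum_distrib_right)
  also have "\<dots> = (\<Sum>f\<in>{f \<in> Pi\<^sub>E Q (\<lambda>_. Q). f ` Q = Q}. \<Prod>q\<in>Q. x (f q) q)"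
    using fin by (simp add: if_distrib[of "\<lambda>c. c * _"] sum.If_cases Int_def cong: if_cong)
  also have "\<dots> = (\<Sum>\<pi> | \<pi> permutes Q. \<Prod>q\<in>Q. x (restrict \<pi> Q q) q)"
    by (rule sum.reindex_bij_betw[OF surj_PiE_permutes_bij[OF Q], symmetric])
  finally show ?thesis by simp
qed

lemma prod_if_one: "finite A \<Longrightarrow> (\<Prod>q\<in>A. if P q then 1 else 0) = (if \<forall>q\<in>A. P q then 1 else 0 :: 'a::comm_semiring_1)"
  by (induction A rule: finite_induct) auto

text \<open>When positions are pairs of matrix indices, the sum over \<open>s\<close> is the entry
  at \<open>y q\<close> of the sum of the elementary matrices at the positions \<open>y0 s\<close>.
  A signed combination of values of a monomial at such matrices thus gives its apolar pairing with
  the monomial described by \<open>y0\<close>.\<close>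

lemma polarization_count:
  assumes "finite Q"
  shows "(\<Sum>S\<in>Pow Q. (- 1) ^ card (Q - S) * (\<Prod>q\<in>Q. \<Sum>s\<in>S. if y q = y0 s then 1 else 0)) =
    (of_nat (card {\<pi>. \<pi> permutes Q \<and> (\<forall>q\<in>Q. y q = y0 (\<pi> q))}) :: 'a::comm_ring_1)"
  using assms finite_permutations[OF assms]
  by (simp add: permanent_Ryser prod_if_one sum.If_cases Int_def)

subsection \<open>Families of permutations\<close>

text \<open>These families index the terms in the expansion of det^M: one permutation for each of
  the \<open>M\<close> factors, which are called blocks.\<close>

definition perm_fams :: "nat \<Rightarrow> nat \<Rightarrow> (nat \<Rightarrow> nat \<Rightarrow> nat) set" where
  "perm_fams M n = Pi\<^sub>E {..<M} (\<lambda>_. {p. p permutes {..<n}})"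

definition fam_sign :: "nat \<Rightarrow> (nat \<Rightarrow> nat \<Rightarrow> nat) \<Rightarrow> 'a::comm_ring_1" where
  "fam_sign M \<tau> = (\<Prod>t<M. of_int (sign (\<tau> t)))"

definition fam_app :: "(nat \<Rightarrow> nat \<Rightarrow> nat) \<Rightarrow> nat \<times> nat \<Rightarrow> nat" where
  "fam_app \<tau> q = \<tau> (fst q) (snd q)"

lemma finite_perm_fams: "finite (perm_fams M n)"
  unfolding perm_fams_def by (intro finite_PiE) (auto simp: finite_permutations)

lemma perm_famsD: "\<tau> \<in> perm_fams M n \<Longrightarrow> t < M \<Longrightarrow> \<tau> t permutes {..<n}"
  by (auto simp: perm_fams_def)

lemma fam_app_less: "\<tau> \<in> perm_fams M n \<Longrightarrow> q \<in> {..<M} \<times> {..<n} \<Longrightarrow> fam_app \<tau> q < n"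
  using perm_famsD[of \<tau> M n "fst q"] permutes_in_image[of "\<tau> (fst q)" "{..<n}" "snd q"]
  by (auto simp: fam_app_def)

lemma sign_compose_permutes:
  "p permutes S \<Longrightarrow> q permutes S \<Longrightarrow> finite S \<Longrightarrow> sign (p \<circ> q) = sign p * sign q"
  by (intro sign_compose) (auto simp: permutation_permutes)

lemma fam_sign_compose:
  assumes "\<tau> \<in> perm_fams M n" "\<sigma> \<in> perm_fams M n"
  shows "fam_sign M (\<lambda>t\<in>{..<M}. \<tau> t \<circ> \<sigma> t) = fam_sign M \<tau> * (fam_sign M \<sigma> :: 'a::comm_ring_1)"
proof -
  have "sign (\<tau> t \<circ> \<sigma> t) = sign (\<tau> t) * sign (\<sigma> t)" if "t < M" for t
    using assms that by (intro sign_compose_permutes[of _ "{..<n}"]) (auto dest: perm_famsD)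
  then show ?thesis unfolding fam_sign_def by (simp flip: prod.distrib)
qed

lemma fam_sign_square: "fam_sign M \<tau> * fam_sign M \<tau> = (1 :: 'a::comm_ring_1)"
  unfolding fam_sign_def by (simp flip: prod.distrib of_int_mult)

text \<open>Composing \<open>\<sigma> t\<close> with the transposition of \<open>a\<close> and
  \<open>b\<close> reverses the sign but keeps the argument of \<open>f\<close>, because
  \<open>\<beta>\<close> agrees at the two slots. The sum equals its own negative, hence vanishes in
  characteristic 0.\<close>

lemma alternating_sum_eq_0:
  fixes f :: "(nat \<times> nat \<Rightarrow> nat) \<Rightarrow> 'k::field_char_0"
  assumes f: "\<And>\<alpha> \<alpha>'. (\<And>q. q \<in> {..<M} \<times> {..<n} \<Longrightarrow> \<alpha> q = \<alpha>' q) \<Longrightarrow> f \<alpha> = f \<alpha>'"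
    and "t < M" "a < n" "b < n" "a \<noteq> b" "\<beta> (t, a) = \<beta> (t, b)"
  shows "(\<Sum>\<sigma>\<in>perm_fams M n. fam_sign M \<sigma> * f (\<lambda>q. \<beta> (fst q, fam_app \<sigma> q))) = 0" (is "?S = 0")
proof -
  define \<phi> where "\<phi> \<sigma> = \<sigma>(t := transpose a b \<circ> \<sigma> t)" for \<sigma> :: "nat \<Rightarrow> nat \<Rightarrow> nat"
  have tr: "transpose a b permutes {..<n}" using assms by (intro permutes_swap_id) auto
  have in_fams: "\<phi> \<sigma> \<in> perm_fams M n" if "\<sigma> \<in> perm_fams M n" for \<sigma>
    using that \<open>t < M\<close> tr unfolding \<phi>_def perm_fams_def
    by (auto simp: PiE_iff extensional_def intro: permutes_compose)
  have invol: "\<phi> (\<phi> \<sigma>) = \<sigma>" for \<sigma> by (auto simp: \<phi>_def fun_eq_iff)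
  have sgn: "fam_sign M (\<phi> \<sigma>) = - (fam_sign M \<sigma> :: 'k)" if "\<sigma> \<in> perm_fams M n" for \<sigma>
  proof -
    have "sign (transpose a b \<circ> \<sigma> t) = - sign (\<sigma> t)"
      using sign_compose_permutes[OF tr perm_famsD[OF that \<open>t < M\<close>]] \<open>a \<noteq> b\<close>
      by (simp add: sign_swap_id)
    moreover have "fam_sign M \<rho> = of_int (sign (\<rho> t)) * (\<Prod>i\<in>{..<M} - {t}. of_int (sign (\<rho> i)) :: 'k)" for \<rho>
      unfolding fam_sign_def using \<open>t < M\<close> by (subst prod.remove[of _ t]) auto
    ultimately show ?thesis by (simp add: \<phi>_def)
  qed
  have "?S = (\<Sum>\<sigma>\<in>perm_fams M n. fam_sign M (\<phi> \<sigma>) * f (\<lambda>q. \<beta> (fst q, fam_app (\<phi> \<sigma>) q)))"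
    by (rule sum.reindex_bij_witness[where i = \<phi> and j = \<phi>]) (auto simp: in_fams invol)
  also have "\<dots> = (\<Sum>\<sigma>\<in>perm_fams M n. - (fam_sign M \<sigma> * f (\<lambda>q. \<beta> (fst q, fam_app \<sigma> q))))"
  proof (intro sum.cong refl)
    fix \<sigma> assume "\<sigma> \<in> perm_fams M n"
    moreover have "f (\<lambda>q. \<beta> (fst q, fam_app (\<phi> \<sigma>) q)) = f (\<lambda>q. \<beta> (fst q, fam_app \<sigma> q))"
      using assms(6) by (intro f) (auto simp: \<phi>_def fam_app_def transpose_def)
    ultimately show "fam_sign M (\<phi> \<sigma>) * f (\<lambda>q. \<beta> (fst q, fam_app (\<phi> \<sigma>) q)) =
        - (fam_sign M \<sigma> * f (\<lambda>q. \<beta> (fst q, fam_app \<sigma> q)))" by (simp add: sgn)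
  qed
  finally have "?S = - ?S" by (simp add: sum_negf)
  then show ?thesis by simp
qed

lemma fam_app_restrict_inj: "inj_on (\<lambda>\<tau>. restrict (fam_app \<tau>) ({..<M} \<times> {..<n})) (perm_fams M n)"
proof (rule inj_onI)
  fix \<tau> \<sigma> assume *: "\<tau> \<in> perm_fams M n" "\<sigma> \<in> perm_fams M n"
    and eq: "restrict (fam_app \<tau>) ({..<M} \<times> {..<n}) = restrict (fam_app \<sigma>) ({..<M} \<times> {..<n})"
  have "\<tau> t s = \<sigma> t s" if "t < M" for t s
  proof (cases "s < n")
    case True
    then show ?thesis using fun_cong[OF eq, of "(t, s)"] that by (simp add: fam_app_def)
  next
    case False
    then show ?thesis
      using permutes_not_in[OF perm_famsD[OF *(1) that]] permutes_not_in[OF perm_famsD[OF *(2) that]] by simp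
  qed
  moreover have "\<tau> t = \<sigma> t" if "\<not> t < M" for t using * that by (auto simp: perm_fams_def PiE_iff extensional_def)
  ultimately show "\<tau> = \<sigma>" by (metis ext)
qed

text \<open>Counterpart of \<open>alternating_sum_eq_0\<close>: an index function that repeats no
  value inside a block is a permutation on every block, so these are the only ones that survive the
  alternating sum.\<close>

lemma fam_app_of_inj:
  assumes \<beta>: "\<beta> \<in> Pi\<^sub>E ({..<M} \<times> {..<n}) (\<lambda>_. {..<n})"
    and inj: "\<And>t a b. t < M \<Longrightarrow> a < n \<Longrightarrow> b < n \<Longrightarrow> \<beta> (t, a) = \<beta> (t, b) \<Longrightarrow> a = b"
  shows "\<exists>\<tau>\<in>perm_fams M n. \<beta> = restrict (fam_app \<tau>) ({..<M} \<times> {..<n})"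
proof -
  define \<tau> where "\<tau> = (\<lambda>t\<in>{..<M}. \<lambda>s. if s < n then \<beta> (t, s) else s)"
  have "\<tau> t permutes {..<n}" if "t < M" for t
  proof (rule bij_imp_permutes)
    have "inj_on (\<tau> t) {..<n}" using inj that by (auto simp: inj_on_def \<tau>_def)
    moreover have "\<tau> t ` {..<n} \<subseteq> {..<n}" using \<beta> that by (auto simp: \<tau>_def)
    ultimately show "bij_betw (\<tau> t) {..<n} {..<n}"
      by (simp add: bij_betw_def endo_inj_surj)
  qed (use that in \<open>auto simp: \<tau>_def\<close>)
  then have "\<tau> \<in> perm_fams M n" by (auto simp: perm_fams_def \<tau>_def)
  moreover have "\<beta> = restrict (fam_app \<tau>) ({..<M} \<times> {..<n})"
    using \<beta> by (auto simp: \<tau>_def fam_app_def fun_eq_iff PiE_iff extensional_def)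
  ultimately show ?thesis by blast
qed

text \<open>A product of two alternating sums is a signed sum of index contractions:
  the tensor identity \<open>\<epsilon> \<epsilon> = det \<delta>\<close>, applied to each of the \<open>M\<close> blocks.\<close>

lemma double_alternating_sum:
  fixes f :: "(nat \<times> nat \<Rightarrow> nat) \<Rightarrow> (nat \<times> nat \<Rightarrow> nat) \<Rightarrow> 'k::field_char_0"
    and M n :: nat
  defines "Q \<equiv> {..<M} \<times> {..<n}"
  assumes f: "\<And>\<alpha> \<alpha>' \<beta> \<beta>'. (\<And>q. q \<in> Q \<Longrightarrow> \<alpha> q = \<alpha>' q) \<Longrightarrow> (\<And>q. q \<in> Q \<Longrightarrow> \<beta> q = \<beta>' q) \<Longrightarrow> f \<alpha> \<beta> = f \<alpha>' \<beta>'"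
  shows "(\<Sum>\<tau>\<in>perm_fams M n. \<Sum>\<tau>'\<in>perm_fams M n.
      fam_sign M \<tau> * fam_sign M \<tau>' * f (fam_app \<tau>) (fam_app \<tau>')) =
    (\<Sum>\<sigma>\<in>perm_fams M n. fam_sign M \<sigma> *
      (\<Sum>\<beta>\<in>Pi\<^sub>E Q (\<lambda>_. {..<n}). f (\<lambda>q. \<beta> (fst q, fam_app \<sigma> q)) \<beta>))"
proof -
  let ?F = "perm_fams M n"
  \<comment> \<open>The right-hand side is sorted by \<open>\<beta>\<close>. If
    \<open>\<beta>\<close> comes from a family \<open>\<tau>'\<close>, substituting
    \<open>\<tau> = \<tau>' \<circ> \<sigma>\<close> blockwise gives the terms of the left-hand side
    with this \<open>\<tau>'\<close>; every other \<open>\<beta>\<close> contributes 0.\<close>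
  define S where "S \<beta> = (\<Sum>\<sigma>\<in>?F. fam_sign M \<sigma> * f (\<lambda>q. \<beta> (fst q, fam_app \<sigma> q)) \<beta>)" for \<beta>
  define R where "R \<tau> = restrict (fam_app \<tau>) Q" for \<tau>
  have fin: "finite (Pi\<^sub>E Q (\<lambda>_. {..<n}))" unfolding Q_def by (intro finite_PiE) auto
  have R_sub: "R ` ?F \<subseteq> Pi\<^sub>E Q (\<lambda>_. {..<n})"
    using fam_app_less unfolding R_def Q_def image_subset_iff restrict_PiE_iff by blast
  have S_R: "S (R \<tau>') = (\<Sum>\<tau>\<in>?F. fam_sign M \<tau> * fam_sign M \<tau>' * f (fam_app \<tau>) (fam_app \<tau>'))"
    if \<tau>': "\<tau>' \<in> ?F" for \<tau>'
  proof -
    define c where "c \<sigma> = (\<lambda>t\<in>{..<M}. \<tau>' t \<circ> \<sigma> t)" for \<sigma> :: "nat \<Rightarrow> nat \<Rightarrow> nat"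
    define c' where "c' \<sigma> = (\<lambda>t\<in>{..<M}. inv_into UNIV (\<tau>' t) \<circ> \<sigma> t)" for \<sigma> :: "nat \<Rightarrow> nat \<Rightarrow> nat"
    have p: "\<tau>' t permutes {..<n}" if "t < M" for t using perm_famsD[OF \<tau>' that] .
    have c: "c \<sigma> \<in> ?F" "c' \<sigma> \<in> ?F" if "\<sigma> \<in> ?F" for \<sigma>
      using that p unfolding c_def c'_def perm_fams_def
      by (auto simp: PiE_iff intro!: permutes_compose permutes_inv)
    have c_inverse: "c' (c \<sigma>) = \<sigma>" "c (c' \<sigma>) = \<sigma>" if "\<sigma> \<in> ?F" for \<sigma>
      using that permutes_inverses[OF p] unfolding c_def c'_def perm_fams_def
      by (auto simp: PiE_iff extensional_def fun_eq_iff)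
    have "S (R \<tau>') = (\<Sum>\<sigma>\<in>?F. fam_sign M (c \<sigma>) * fam_sign M \<tau>' * f (fam_app (c \<sigma>)) (fam_app \<tau>'))"
      unfolding S_def
    proof (intro sum.cong refl)
      fix \<sigma> assume \<sigma>: "\<sigma> \<in> ?F"
      have "f (\<lambda>q. R \<tau>' (fst q, fam_app \<sigma> q)) (R \<tau>') = f (fam_app (c \<sigma>)) (fam_app \<tau>')"
        using fam_app_less[OF \<sigma>] by (intro f) (auto simp: R_def Q_def c_def fam_app_def)
      moreover have "fam_sign M (c \<sigma>) * fam_sign M \<tau>' = (fam_sign M \<sigma> :: 'k)"
        using fam_sign_compose[OF \<tau>' \<sigma>, where 'a = 'k] fam_sign_square[of M \<tau>', where 'a = 'k]
        unfolding c_def by (simp add: mult_ac mult.assoc[symmetric])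
      ultimately show "fam_sign M \<sigma> * f (\<lambda>q. R \<tau>' (fst q, fam_app \<sigma> q)) (R \<tau>') =
          fam_sign M (c \<sigma>) * fam_sign M \<tau>' * f (fam_app (c \<sigma>)) (fam_app \<tau>')" by simp
    qed
    also have "\<dots> = (\<Sum>\<tau>\<in>?F. fam_sign M \<tau> * fam_sign M \<tau>' * f (fam_app \<tau>) (fam_app \<tau>'))"
      by (rule sum.reindex_bij_witness[where i = c' and j = c]) (auto simp: c c_inverse)
    finally show ?thesis .
  qed
  have S_0: "S \<beta> = 0" if "\<beta> \<in> Pi\<^sub>E Q (\<lambda>_. {..<n}) - R ` ?F" for \<beta>
  proof -
    from that fam_app_of_inj[of \<beta> M n] obtain t a b
      where "t < M" "a < n" "b < n" "\<beta> (t, a) = \<beta> (t, b)" "a \<noteq> b"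
      unfolding R_def Q_def by blast
    then show ?thesis unfolding S_def
      using alternating_sum_eq_0[of M n "\<lambda>\<alpha>. f \<alpha> \<beta>" t a b \<beta>] f unfolding Q_def by blast
  qed
  have "(\<Sum>\<sigma>\<in>?F. fam_sign M \<sigma> *
      (\<Sum>\<beta>\<in>Pi\<^sub>E Q (\<lambda>_. {..<n}). f (\<lambda>q. \<beta> (fst q, fam_app \<sigma> q)) \<beta>)) = (\<Sum>\<beta>\<in>Pi\<^sub>E Q (\<lambda>_. {..<n}). S \<beta>)"
    unfolding S_def by (simp add: sum_distrib_left sum.swap[of _ ?F])
  also have "\<dots> = sum S (R ` ?F)"
    by (rule sum.mono_neutral_right) (use fin R_sub S_0 in auto)
  also have "\<dots> = (\<Sum>\<tau>'\<in>?F. S (R \<tau>'))"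
    using fam_app_restrict_inj[of M n] unfolding R_def Q_def by (subst sum.reindex) auto
  also have "\<dots> = (\<Sum>\<tau>\<in>?F. \<Sum>\<tau>'\<in>?F. fam_sign M \<tau> * fam_sign M \<tau>' * f (fam_app \<tau>) (fam_app \<tau>'))"
    by (subst sum.swap) (simp add: S_R)
  finally show ?thesis by simp
qed

text \<open>This is the value of the differential operator det(d/dg)^M on det(g)^M; the cardinality
  counts the ways of matching derivatives with factors. The type is left general so that positivity
  can be shown over the integers and then carried over to the field.\<close>

definition fam_coeff :: "nat \<Rightarrow> nat \<Rightarrow> 'a::comm_ring_1" where
  "fam_coeff M n = (\<Sum>\<tau>\<in>perm_fams M n. \<Sum>\<tau>'\<in>perm_fams M n. fam_sign M \<tau> * fam_sign M \<tau>' *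
     of_nat (card {\<pi>. \<pi> permutes {..<M} \<times> {..<n} \<and>
       (\<forall>q\<in>{..<M} \<times> {..<n}. (snd q, fam_app \<tau>' q) = (snd (\<pi> q), fam_app \<tau> (\<pi> q)))}))"

lemma fam_coeff_of_int: "of_int (fam_coeff M n) = fam_coeff M n"
  by (simp add: fam_coeff_def fam_sign_def)

text \<open>Up to the factor \<open>|H|\<close>, the coefficient is a sum of squares.\<close>

lemma fam_coeff_pos: "fam_coeff M n > (0 :: int)"
proof -
  define Q where "Q = {..<M} \<times> {..<n}"
  \<comment> \<open>Slots with the same row index can be exchanged without changing the rows of a
    monomial. The \<open>S\<close> below is the coefficient tensor of det^M, symmetrized over this
    group.\<close>
  define H where "H = {\<pi>. \<pi> permutes Q \<and> (\<forall>q\<in>Q. snd (\<pi> q) = snd q)}"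
  define K where "K = Pi\<^sub>E Q (\<lambda>_. {..<n})"
  let ?F = "perm_fams M n"
  define e where "e \<tau> \<pi> \<kappa> = (if \<forall>q\<in>Q. \<kappa> q = fam_app \<tau> (\<pi> q) then 1 else 0 :: int)" for \<tau> \<pi> \<kappa>
  define S where "S \<kappa> = (\<Sum>\<tau>\<in>?F. \<Sum>\<pi>\<in>H. fam_sign M \<tau> * e \<tau> \<pi> \<kappa>)" for \<kappa>
  have finQ: "finite Q" and finK: "finite K" unfolding Q_def K_def by (auto intro!: finite_PiE)
  have finH: "finite H" unfolding H_def using finite_permutations[OF finQ] by (rule rev_finite_subset) auto
  have H_Q: "\<pi> q \<in> Q" if "\<pi> \<in> H" "q \<in> Q" for \<pi> q
    using that permutes_in_image[of \<pi> Q q] unfolding H_def by simp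
  have id_H: "id \<in> H" by (auto simp: H_def permutes_id)
  have comp_H: "\<pi> \<circ> \<rho> \<in> H" if "\<pi> \<in> H" "\<rho> \<in> H" for \<pi> \<rho>
    using that H_Q[OF that(2)] by (auto simp: H_def intro: permutes_compose)
  have inv_H: "inv_into UNIV \<pi> \<in> H" if "\<pi> \<in> H" for \<pi>
  proof -
    have p: "\<pi> permutes Q" using that by (simp add: H_def)
    have "snd (inv_into UNIV \<pi> q) = snd q" if "q \<in> Q" for q
      using \<open>\<pi> \<in> H\<close> permutes_inverses(1)[OF p, of q] permutes_in_image[OF permutes_inv[OF p], of q] that
      unfolding H_def by (metis (mono_tags, lifting) mem_Collect_eq)
    then show ?thesis using permutes_inv[OF p] by (simp add: H_def)
  qed
  have app_K: "restrict (\<lambda>q. fam_app \<tau> (\<pi> q)) Q \<in> K" if "\<tau> \<in> ?F" "\<pi> \<in> H" for \<tau> \<pi>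
    using that H_Q fam_app_less unfolding K_def Q_def restrict_PiE_iff by blast
  have sum_e: "(\<Sum>\<kappa>\<in>K. e \<tau> \<pi> \<kappa> * e \<tau>' \<pi>' \<kappa>) =
      (if \<forall>q\<in>Q. fam_app \<tau> (\<pi> q) = fam_app \<tau>' (\<pi>' q) then 1 else 0)"
    if "\<tau> \<in> ?F" "\<pi> \<in> H" for \<tau> \<tau>' \<pi> \<pi>'
  proof -
    have "(\<Sum>\<kappa>\<in>K. e \<tau> \<pi> \<kappa> * e \<tau>' \<pi>' \<kappa>) =
        (\<Sum>\<kappa>\<in>K. if \<forall>q\<in>Q. \<kappa> q = fam_app \<tau> (\<pi> q) then e \<tau>' \<pi>' \<kappa> else 0)"
      by (intro sum.cong) (auto simp: e_def)
    also have "\<dots> = e \<tau>' \<pi>' (restrict (\<lambda>q. fam_app \<tau> (\<pi> q)) Q)"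
      unfolding K_def by (rule sum_PiE_delta) (use finQ that H_Q fam_app_less in \<open>auto simp: Q_def\<close>)
    finally show ?thesis by (simp add: e_def cong: ball_cong)
  qed
  have coeff: "fam_coeff M n = (\<Sum>\<tau>\<in>?F. \<Sum>\<tau>'\<in>?F. fam_sign M \<tau> * fam_sign M \<tau>' *
      (\<Sum>\<pi>\<in>H. if \<forall>q\<in>Q. fam_app \<tau>' q = fam_app \<tau> (\<pi> q) then 1 else 0 :: int))"
    unfolding fam_coeff_def Q_def[symmetric]
  proof (intro sum.cong refl arg_cong2[of _ _ _ _ "(*)"])
    fix \<tau> \<tau>'
    have "{\<pi>. \<pi> permutes Q \<and> (\<forall>q\<in>Q. (snd q, fam_app \<tau>' q) = (snd (\<pi> q), fam_app \<tau> (\<pi> q)))} =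
        {\<pi>\<in>H. \<forall>q\<in>Q. fam_app \<tau>' q = fam_app \<tau> (\<pi> q)}" by (auto simp: H_def)
    then show "int (card {\<pi>. \<pi> permutes Q \<and> (\<forall>q\<in>Q. (snd q, fam_app \<tau>' q) = (snd (\<pi> q), fam_app \<tau> (\<pi> q)))}) =
        (\<Sum>\<pi>\<in>H. if \<forall>q\<in>Q. fam_app \<tau>' q = fam_app \<tau> (\<pi> q) then 1 else 0)"
      using finH by (simp add: sum.If_cases Int_def)
  qed
  \<comment> \<open>Only the position of \<open>\<pi>\<close> relative to \<open>\<rho>\<close>
    matters, so replacing \<open>\<pi>\<close> by \<open>\<pi> \<circ> \<rho>\<close> removes
    \<open>\<rho>\<close>; summing over \<open>\<rho>\<close> then yields the factor
    \<open>card H\<close>.\<close>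
  have shift: "(\<Sum>\<pi>\<in>H. if \<forall>q\<in>Q. fam_app \<tau> (\<pi> q) = fam_app \<tau>' (\<rho> q) then 1 else 0 :: int) =
      (\<Sum>\<pi>\<in>H. if \<forall>q\<in>Q. fam_app \<tau>' q = fam_app \<tau> (\<pi> q) then 1 else 0)" if \<rho>: "\<rho> \<in> H" for \<rho> \<tau> \<tau>'
  proof (rule sum.reindex_bij_witness[where i = "\<lambda>\<pi>. \<pi> \<circ> \<rho>" and j = "\<lambda>\<pi>. \<pi> \<circ> inv_into UNIV \<rho>"])
    fix \<pi> assume "\<pi> \<in> H"
    have p: "\<rho> permutes Q" using \<rho> by (simp add: H_def)
    show "\<pi> \<circ> inv_into UNIV \<rho> \<circ> \<rho> = \<pi>" "\<pi> \<circ> \<rho> \<circ> inv_into UNIV \<rho> = \<pi>"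
      using permutes_inverses[OF p] by (auto simp: fun_eq_iff)
    show "\<pi> \<circ> inv_into UNIV \<rho> \<in> H" "\<pi> \<circ> \<rho> \<in> H" using \<open>\<pi> \<in> H\<close> \<rho> comp_H inv_H by auto
    have "(\<forall>q\<in>Q. fam_app \<tau> (\<pi> q) = fam_app \<tau>' (\<rho> q)) \<longleftrightarrow> (\<forall>q\<in>\<rho> ` Q. fam_app \<tau>' q = fam_app \<tau> (\<pi> (inv_into UNIV \<rho> q)))"
      using permutes_inverses[OF p] by auto
    then show "(if \<forall>q\<in>Q. fam_app \<tau>' q = fam_app \<tau> ((\<pi> \<circ> inv_into UNIV \<rho>) q) then 1 else 0) =
        (if \<forall>q\<in>Q. fam_app \<tau> (\<pi> q) = fam_app \<tau>' (\<rho> q) then 1 else 0 :: int)"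
      using permutes_image[OF p] by simp
  qed
  have "(\<Sum>\<kappa>\<in>K. (S \<kappa>)\<^sup>2) = (\<Sum>\<kappa>\<in>K. \<Sum>z\<in>?F \<times> H. \<Sum>z'\<in>?F \<times> H.
      fam_sign M (fst z) * e (fst z) (snd z) \<kappa> * (fam_sign M (fst z') * e (fst z') (snd z') \<kappa>))"
    unfolding S_def power2_eq_square sum.cartesian_product sum_product case_prod_unfold ..
  also have "\<dots> = (\<Sum>z\<in>?F \<times> H. \<Sum>z'\<in>?F \<times> H. \<Sum>\<kappa>\<in>K.
      fam_sign M (fst z) * e (fst z) (snd z) \<kappa> * (fam_sign M (fst z') * e (fst z') (snd z') \<kappa>))"
    by (subst sum.swap, intro sum.cong refl, rule sum.swap)
  also have "\<dots> = (\<Sum>z\<in>?F \<times> H. \<Sum>z'\<in>?F \<times> H. fam_sign M (fst z) * fam_sign M (fst z') *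
      (\<Sum>\<kappa>\<in>K. e (fst z) (snd z) \<kappa> * e (fst z') (snd z') \<kappa>))"
    unfolding sum_distrib_left by (intro sum.cong refl) (simp only: mult_ac)
  also have "\<dots> = (\<Sum>z\<in>?F \<times> H. \<Sum>z'\<in>?F \<times> H. fam_sign M (fst z) * fam_sign M (fst z') *
      (if \<forall>q\<in>Q. fam_app (fst z) (snd z q) = fam_app (fst z') (snd z' q) then 1 else 0))"
    by (intro sum.cong refl arg_cong2[of _ _ _ _ "(*)"] sum_e) auto
  also have "\<dots> = (\<Sum>\<tau>\<in>?F. \<Sum>\<pi>\<in>H. \<Sum>\<tau>'\<in>?F. \<Sum>\<rho>\<in>H. fam_sign M \<tau> * fam_sign M \<tau>' *
      (if \<forall>q\<in>Q. fam_app \<tau> (\<pi> q) = fam_app \<tau>' (\<rho> q) then 1 else 0))"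
    by (simp only: sum.cartesian_product' fst_conv snd_conv)
  also have "\<dots> = (\<Sum>\<tau>\<in>?F. \<Sum>\<tau>'\<in>?F. \<Sum>\<rho>\<in>H. \<Sum>\<pi>\<in>H. fam_sign M \<tau> * fam_sign M \<tau>' *
      (if \<forall>q\<in>Q. fam_app \<tau> (\<pi> q) = fam_app \<tau>' (\<rho> q) then 1 else 0))"
    by (rule sum.cong[OF refl], rule trans[OF sum.swap], rule sum.cong[OF refl], rule sum.swap)
  also have "\<dots> = (\<Sum>\<tau>\<in>?F. \<Sum>\<tau>'\<in>?F. \<Sum>\<rho>\<in>H. fam_sign M \<tau> * fam_sign M \<tau>' *
      (\<Sum>\<pi>\<in>H. if \<forall>q\<in>Q. fam_app \<tau>' q = fam_app \<tau> (\<pi> q) then 1 else 0))"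
    by (intro sum.cong refl) (simp only: sum_distrib_left[symmetric] shift)
  also have "\<dots> = of_nat (card H) * fam_coeff M n"
    unfolding coeff sum_distrib_left[of "of_nat (card H)"] by (intro sum.cong refl) (simp only: sum_constant)
  finally have eq: "(\<Sum>\<kappa>\<in>K. (S \<kappa>)\<^sup>2) = of_nat (card H) * fam_coeff M n" .
  \<comment> \<open>One nonzero square suffices, and the diagonal term of det^M provides it: column
    indices equal to the row indices are matched by the identity family alone.\<close>
  define \<iota> :: "nat \<Rightarrow> nat \<Rightarrow> nat" where "\<iota> = (\<lambda>t\<in>{..<M}. id)"
  have \<iota>: "\<iota> \<in> ?F" by (auto simp: \<iota>_def perm_fams_def permutes_id)
  define \<kappa>\<^sub>0 where "\<kappa>\<^sub>0 = restrict snd Q"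
  have e0: "e \<tau> \<pi> \<kappa>\<^sub>0 = (if \<tau> = \<iota> then 1 else 0)" if "\<tau> \<in> ?F" "\<pi> \<in> H" for \<tau> \<pi>
  proof -
    have p: "\<pi> permutes Q" using that by (simp add: H_def)
    have "(\<forall>q\<in>Q. \<kappa>\<^sub>0 q = fam_app \<tau> (\<pi> q)) \<longleftrightarrow> (\<forall>q\<in>Q. snd (\<pi> q) = fam_app \<tau> (\<pi> q))"
      using that by (auto simp: \<kappa>\<^sub>0_def H_def)
    also have "\<dots> \<longleftrightarrow> (\<forall>q\<in>\<pi> ` Q. snd q = fam_app \<tau> q)" by auto
    also have "\<dots> \<longleftrightarrow> restrict (fam_app \<tau>) Q = restrict (fam_app \<iota>) Q"
      using permutes_image[OF p] by (auto simp: fun_eq_iff \<iota>_def fam_app_def Q_def restrict_def)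
    also have "\<dots> \<longleftrightarrow> \<tau> = \<iota>"
      using inj_on_eq_iff[OF fam_app_restrict_inj that(1) \<iota>] unfolding Q_def .
    finally show ?thesis by (simp add: e_def)
  qed
  have "S \<kappa>\<^sub>0 = (\<Sum>\<tau>\<in>?F. \<Sum>\<pi>\<in>H. if \<tau> = \<iota> then 1 else 0)"
    unfolding S_def
    by (intro sum.cong refl) (auto simp: e0 fam_sign_def \<iota>_def)
  also have "\<dots> = (\<Sum>\<tau>\<in>?F. if \<tau> = \<iota> then int (card H) else 0)"
    by (intro sum.cong refl) (auto simp only: sum_constant mult_1_right mult_zero_right split: if_split)
  also have "\<dots> = of_nat (card H)"
    using \<iota> finite_perm_fams[of M n] by (simp only: sum.delta' sum.delta if_True)
  finally have "S \<kappa>\<^sub>0 = of_nat (card H)" .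
  moreover have H0: "card H > 0" using id_H finH by (auto simp: card_gt_0_iff)
  moreover have "\<kappa>\<^sub>0 \<in> K" by (auto simp: K_def \<kappa>\<^sub>0_def Q_def)
  ultimately have "(\<Sum>\<kappa>\<in>K. (S \<kappa>)\<^sup>2) > 0"
    using finK by (intro sum_pos2[of _ \<kappa>\<^sub>0]) auto
  then show ?thesis using eq H0 by (simp add: zero_less_mult_iff)
qed

lemma fam_coeff_nonzero: "fam_coeff M n \<noteq> (0 :: 'a::field_char_0)"
proof -
  have "of_int (fam_coeff M n) \<noteq> (0 :: 'a)" using fam_coeff_pos[of M n] by simp
  then show ?thesis unfolding fam_coeff_of_int .
qed

subsection \<open>Noncommutative polynomials as a vector space\<close>

definition npmon :: "'x list \<Rightarrow> ('x, 'k::comm_ring_1) ncpoly" where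
  "npmon w = (\<lambda>u. if u = w then 1 else 0)"

lemma sum_fun_apply: "(sum f A) x = (\<Sum>a\<in>A. f a x)"
  by (induction A rule: infinite_finite_induct) auto

text \<open>The operations on polynomials become those of the type classes on functions, so that the
  facts about vector spaces and finite sums apply.\<close>

lemma np_eqs:
  "npadd p q = p + q" "npsub p q = p - q" "npzero = 0" "npsum f A = sum f A"
  "npone = npmon []" "npvar x = npmon [x]"
  by (auto simp: npadd_def npsub_def npzero_def npsum_def npone_def npvar_def npmon_def
      fun_eq_iff sum_fun_apply)

interpretation np: vector_space "npscale :: 'k::field \<Rightarrow> ('x, 'k) ncpoly \<Rightarrow> ('x, 'k) ncpoly"
  by unfold_locales (auto simp: npscale_def fun_eq_iff algebra_simps)

lemma npmul_linear:
  fixes p q :: "('x, 'k::comm_ring_1) ncpoly"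
  shows npmul_add_left: "npmul (p + q) r = npmul p r + npmul q r"
    and npmul_add_right: "npmul r (p + q) = npmul r p + npmul r q"
    and npmul_diff_left: "npmul (p - q) r = npmul p r - npmul q r"
    and npmul_diff_right: "npmul r (p - q) = npmul r p - npmul r q"
    and npmul_scale_left: "npmul (npscale c p) r = npscale c (npmul p r)"
    and npmul_scale_right: "npmul r (npscale c p) = npscale c (npmul r p)"
    and npmul_zero_left: "npmul 0 r = 0"
    and npmul_zero_right: "npmul r 0 = 0"
  by (auto simp: npmul_def npscale_def fun_eq_iff algebra_simps sum.distrib sum_subtractf sum_distrib_left)

lemma npmul_sum_left: "npmul (sum f A) r = (\<Sum>a\<in>A. npmul (f a) r)"
  using sum_comp_morphism[of "\<lambda>p. npmul p r" f A] by (simp add: npmul_linear comp_def)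

lemma npmul_sum_right: "npmul r (sum f A) = (\<Sum>a\<in>A. npmul r (f a))"
  using sum_comp_morphism[of "npmul r" f A] by (simp add: npmul_linear comp_def)

lemma npmul_npmon: "npmul (npmon u) (npmon v) = (npmon (u @ v) :: ('x, 'k::comm_ring_1) ncpoly)"
proof
  fix w
  have "npmul (npmon u) (npmon v) w = (\<Sum>i\<le>length w. if i = length u then (if w = u @ v then 1 else 0) else 0 :: 'k)"
    unfolding npmul_def
  proof (intro sum.cong refl)
    fix i assume "i \<in> {..length w}"
    then have "take i w = u \<and> drop i w = v \<longleftrightarrow> i = length u \<and> w = u @ v"
      by (metis append_take_drop_id append_eq_conv_conj atMost_iff length_take min.absorb2)
    moreover have "npmon u (take i w) * npmon v (drop i w) = (if take i w = u \<and> drop i w = v then 1 else 0 :: 'k)"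
      by (simp add: npmon_def)
    ultimately show "npmon u (take i w) * npmon v (drop i w) = (if i = length u then (if w = u @ v then 1 else 0) else 0 :: 'k)"
      by simp
  qed
  then show "npmul (npmon u) (npmon v) w = (npmon (u @ v) w :: 'k)" by (auto simp: npmon_def)
qed

lemma npmul_one_left: "npmul (npmon []) p = (p :: ('x, 'k::comm_ring_1) ncpoly)"
proof
  fix w
  have "npmul (npmon []) p w = (\<Sum>i\<le>length w. if i = 0 then p w else 0)"
    unfolding npmul_def npmon_def by (intro sum.cong) auto
  then show "npmul (npmon []) p w = p w" by simp
qed

lemma npmul_one_right: "npmul p (npmon []) = (p :: ('x, 'k::comm_ring_1) ncpoly)"
proof
  fix w
  have "npmul p (npmon []) w = (\<Sum>i\<le>length w. if i = length w then p w else 0)"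
    unfolding npmul_def npmon_def by (intro sum.cong) auto
  then show "npmul p (npmon []) w = p w" by simp
qed

lemma npPol_subspace:
  fixes V :: "'a \<Rightarrow> bool"
  shows "np.subspace (npPol V :: ('a, 'b::field) ncpoly set)"
proof (rule np.subspaceI)
  show "0 \<in> npPol V" by (simp add: npPol_def)
next
  fix p q :: "('a, 'b) ncpoly" assume *: "p \<in> npPol V" "q \<in> npPol V"
  then have "finite ({w. p w \<noteq> 0} \<union> {w. q w \<noteq> 0})" by (auto simp: npPol_def)
  then have "finite {w. (p + q) w \<noteq> 0}" by (rule rev_finite_subset) auto
  then show "p + q \<in> npPol V" using * unfolding npPol_def by (auto, metis add_cancel_right_left)
next
  fix c :: 'b and p :: "('a, 'b) ncpoly" assume "p \<in> npPol V"
  then show "npscale c p \<in> npPol V" by (auto simp: npPol_def npscale_def)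
qed

lemma npmon_in_npPol: "list_all V w \<Longrightarrow> npmon w \<in> npPol V"
  by (auto simp: npPol_def npmon_def list_all_iff)

lemma np_ideal_subspace:
  fixes S :: "('a, 'b::field) ncpoly set"
  shows "np.subspace (np_ideal V S)"
proof (rule np.subspaceI)
  show "0 \<in> np_ideal V S" using np_ideal.zero by (simp add: np_eqs)
next
  fix p q :: "('a, 'b) ncpoly" assume "p \<in> np_ideal V S" "q \<in> np_ideal V S"
  then show "p + q \<in> np_ideal V S" using np_ideal.add by (simp add: np_eqs)
next
  fix c :: 'b and p :: "('a, 'b) ncpoly" assume "p \<in> np_ideal V S"
  \<comment> \<open>Scalar multiples come from the absorption rule, as products with constant
    polynomials.\<close>
  moreover have "npscale c (npmon []) \<in> npPol V"
    by (rule np.subspace_scale[OF npPol_subspace npmon_in_npPol]) simp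
  ultimately have "npmul (npscale c (npmon [])) p \<in> np_ideal V S" by (rule np_ideal.lmul)
  then show "npscale c p \<in> np_ideal V S" by (simp add: npmul_linear npmul_one_left)
qed

lemma foldr_npmul_linear:
  shows foldr_npmul_diff: "foldr npmul xs (p - q) = foldr npmul xs p - foldr npmul xs q"
    and foldr_npmul_scale: "foldr npmul xs (npscale c p) = npscale c (foldr npmul xs p)"
    and foldr_npmul_sum: "foldr npmul xs (sum f A) = (\<Sum>a\<in>A. foldr npmul xs (f a))"
  by (induction xs) (simp_all add: npmul_linear npmul_sum_right)

text \<open>Distributivity for a product of \<open>M\<close> linear forms in the letters. The tail
  \<open>w\<close> is arbitrary because the induction splits off the last factor, whose letter is
  absorbed in front of \<open>w\<close>.\<close>

lemma foldr_npmul_expand: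
  fixes f :: "nat \<Rightarrow> ('x, 'k::field) ncpoly"
  assumes "\<And>t. t < M \<Longrightarrow> f t = (\<Sum>z\<in>Z. npscale (c t z) (npmon [y t z]))"
  shows "foldr npmul (map f [0..<M]) (npmon w) =
    (\<Sum>\<zeta>\<in>Pi\<^sub>E {..<M} (\<lambda>_. Z). npscale (\<Prod>t<M. c t (\<zeta> t)) (npmon (map (\<lambda>t. y t (\<zeta> t)) [0..<M] @ w)))"
  using assms
proof (induction M arbitrary: w)
  case (Suc M)
  have "foldr npmul (map f [0..<Suc M]) (npmon w) =
      (\<Sum>z\<in>Z. npscale (c M z) (foldr npmul (map f [0..<M]) (npmon (y M z # w))))"
    by (simp add: Suc.prems[of M] npmul_sum_left npmul_linear npmul_npmon foldr_npmul_linear)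
  also have "\<dots> = (\<Sum>z\<in>Z. \<Sum>\<zeta>\<in>Pi\<^sub>E {..<M} (\<lambda>_. Z). npscale (\<Prod>t<Suc M. c t ((\<zeta>(M := z)) t))
      (npmon (map (\<lambda>t. y t ((\<zeta>(M := z)) t)) [0..<Suc M] @ w)))"
  proof (rule sum.cong[OF refl])
    fix z
    have "npscale (c M z) (npscale (\<Prod>t<M. c t (\<zeta> t)) (npmon (map (\<lambda>t. y t (\<zeta> t)) [0..<M] @ y M z # w))) =
        npscale (\<Prod>t<Suc M. c t ((\<zeta>(M := z)) t)) (npmon (map (\<lambda>t. y t ((\<zeta>(M := z)) t)) [0..<Suc M] @ w))"
      for \<zeta>
    proof -
      have "npmon (map (\<lambda>t. y t ((\<zeta>(M := z)) t)) [0..<Suc M] @ w) =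
          (npmon (map (\<lambda>t. y t (\<zeta> t)) [0..<M] @ y M z # w) :: ('x, 'k) ncpoly)"
        by (rule arg_cong[of _ _ npmon]) simp
      moreover have "(\<Prod>t<Suc M. c t ((\<zeta>(M := z)) t)) = c M z * (\<Prod>t<M. c t (\<zeta> t))"
        by (simp add: mult.commute)
      ultimately show ?thesis by (simp only: np.scale_scale)
    qed
    then show "npscale (c M z) (foldr npmul (map f [0..<M]) (npmon (y M z # w))) =
        (\<Sum>\<zeta>\<in>Pi\<^sub>E {..<M} (\<lambda>_. Z). npscale (\<Prod>t<Suc M. c t ((\<zeta>(M := z)) t))
          (npmon (map (\<lambda>t. y t ((\<zeta>(M := z)) t)) [0..<Suc M] @ w)))"
      using Suc.prems by (subst Suc.IH) (simp_all only: less_SucI np.scale_sum_right)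
  qed
  finally show ?case by (simp add: lessThan_Suc sum_PiE_insert[of M "{..<M}"])
qed simp

subsection \<open>Congruence modulo the defining relations\<close>

locale graded_rep =
  fixes smul :: "'k::field_char_0 \<Rightarrow> 'r::ring_1 \<Rightarrow> 'r" and G :: "int \<Rightarrow> 'r set" and n :: nat
  assumes one_homogeneous: "1 \<in> G 0"
    and mult_homogeneous: "r \<in> G a \<Longrightarrow> s \<in> G b \<Longrightarrow> r * s \<in> G (a + b)"
begin

abbreviation I :: "('r rgen, 'k) ncpoly set" where "I \<equiv> Rn_ideal smul G n"

abbreviation V :: "'r rgen \<Rightarrow> bool" where "V \<equiv> rvalid G n"

definition equ :: "('r rgen, 'k) ncpoly \<Rightarrow> ('r rgen, 'k) ncpoly \<Rightarrow> bool" (infix "\<approx>" 50) where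
  "p \<approx> q \<longleftrightarrow> p - q \<in> I"

lemma I_subspace: "np.subspace I"
  unfolding Rn_ideal_def by (rule np_ideal_subspace)

lemma equ_refl [simp, intro]: "p \<approx> p"
  using np.subspace_0[OF I_subspace] by (simp add: equ_def)

lemma equ_sym: "p \<approx> q \<Longrightarrow> q \<approx> p"
  using np.subspace_neg[OF I_subspace, of "p - q"] by (simp add: equ_def)

lemma equ_trans [trans]: "p \<approx> q \<Longrightarrow> q \<approx> r \<Longrightarrow> p \<approx> r"
  using np.subspace_add[OF I_subspace, of "p - q" "q - r"] by (simp add: equ_def)

lemma equ_eq_trans [trans]: "p \<approx> q \<Longrightarrow> q = r \<Longrightarrow> p \<approx> r" "p = q \<Longrightarrow> q \<approx> r \<Longrightarrow> p \<approx> r"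
  by simp_all

lemma equ_add: "p \<approx> q \<Longrightarrow> p' \<approx> q' \<Longrightarrow> p + p' \<approx> q + q'"
  using np.subspace_add[OF I_subspace, of "p - q" "p' - q'"] by (simp add: equ_def algebra_simps)

lemma equ_scale: "p \<approx> q \<Longrightarrow> npscale c p \<approx> npscale c q"
  using np.subspace_scale[OF I_subspace, of "p - q" c] by (simp add: equ_def np.scale_right_diff_distrib)

lemma equ_sum: "(\<And>a. a \<in> A \<Longrightarrow> f a \<approx> g a) \<Longrightarrow> sum f A \<approx> sum g A"
  using np.subspace_sum[OF I_subspace, of A "\<lambda>a. f a - g a"] by (simp add: equ_def sum_subtractf)

lemma equ_npmul_left: "p \<approx> q \<Longrightarrow> r \<in> npPol V \<Longrightarrow> npmul r p \<approx> npmul r q"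
  unfolding equ_def Rn_ideal_def npmul_linear[symmetric] by (rule np_ideal.lmul)

lemma equ_npmul_right: "p \<approx> q \<Longrightarrow> r \<in> npPol V \<Longrightarrow> npmul p r \<approx> npmul q r"
  unfolding equ_def Rn_ideal_def npmul_linear[symmetric] by (rule np_ideal.rmul)

text \<open>The ideal absorbs only polynomials in valid letters, which is the source of the
  \<open>list_all V\<close> conditions in the rewriting rules for words.\<close>

lemma equ_sandwich:
  assumes "p \<approx> q" "list_all V u" "list_all V v"
  shows "npmul (npmon u) (npmul p (npmon v)) \<approx> npmul (npmon u) (npmul q (npmon v))"
  using assms by (intro equ_npmul_left equ_npmul_right npmon_in_npPol)

lemma equ_rel: "npsub p q \<in> Rn_rels smul G n \<Longrightarrow> p \<approx> q"
  unfolding equ_def Rn_ideal_def np_eqs(2)[symmetric] by (rule np_ideal.base)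

text \<open>Multiplicativity in the direction that removes a contracted index between two adjacent
  letters.\<close>

lemma equ_mult:
  assumes "r \<in> G a" "s \<in> G b" "i < n" "j < n" "list_all V u" "list_all V v"
  shows "(\<Sum>l<n. npmon (u @ (a, r, i, l) # (b, s, l, j) # v)) \<approx> npmon (u @ (a + b, r * s, i, j) # v)"
proof -
  have "npvar (a + b, r * s, i, j) \<approx> npsum (\<lambda>l. npmul (npvar (a, r, i, l)) (npvar (b, s, l, j))) {..<n}"
    by (rule equ_rel) (use assms in \<open>unfold Rn_rels_def, blast\<close>)
  from equ_sandwich[OF equ_sym[OF this] assms(5,6)] show ?thesis
    by (simp add: np_eqs npmul_sum_left npmul_sum_right npmul_npmon)
qed

lemma equ_unit:
  assumes "i < n" "j < n" "list_all V u" "list_all V v"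
  shows "npmon (u @ (0, 1, i, j) # v) \<approx> (if i = j then npmon (u @ v) else 0)"
proof -
  have "npvar (0, 1, i, j) \<approx> (if i = j then npone else npzero)"
    by (rule equ_rel) (use assms in \<open>unfold Rn_rels_def, blast\<close>)
  from equ_sandwich[OF this assms(3,4)] show ?thesis
    by (simp add: np_eqs npmul_npmon npmul_linear split: if_splits)
qed

lemma equ_swap:
  assumes "V x" "V y" "list_all V u" "list_all V v"
  shows "npmon (u @ x # y # v) \<approx> npscale (ksign (rdeg x) (rdeg y)) (npmon (u @ y # x # v))"
proof -
  have "npmul (npvar x) (npvar y) \<approx> npscale (ksign (rdeg x) (rdeg y)) (npmul (npvar y) (npvar x))"
    by (rule equ_rel) (use assms in \<open>unfold Rn_rels_def, blast\<close>)
  from equ_sandwich[OF this assms(3,4)] show ?thesis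
    by (simp add: np_eqs npmul_npmon npmul_linear)
qed

lemma equ_move:
  assumes "V y" "list_all V u" "list_all V bs" "list_all V v"
  shows "npmon (u @ bs @ y # v) \<approx>
    npscale (prod_list (map (\<lambda>b. ksign (rdeg b) (rdeg y)) bs)) (npmon (u @ y # bs @ v))"
  using assms
proof (induction bs arbitrary: u)
  case (Cons b bs)
  let ?s = "prod_list (map (\<lambda>b. ksign (rdeg b) (rdeg y)) bs) :: 'k"
  have "npmon (u @ (b # bs) @ y # v) \<approx> npscale ?s (npmon ((u @ [b]) @ y # bs @ v))"
    using Cons.IH[of "u @ [b]"] Cons.prems by simp
  also have "npscale ?s (npmon ((u @ [b]) @ y # bs @ v)) \<approx>
      npscale ?s (npscale (ksign (rdeg b) (rdeg y)) (npmon (u @ y # b # bs @ v)))"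
    using equ_swap[of b y u "bs @ v"] Cons.prems by (intro equ_scale) simp
  finally show ?case by (simp add: mult.commute)
qed simp

subsection \<open>Contracted words are trace polynomials\<close>

text \<open>The preimage, in the free algebra, of the degree \<open>m\<close> part of the image of
  the trace map. Being closed under congruence, it spares carrying explicit trace polynomials
  along.\<close>

definition traces :: "int \<Rightarrow> ('r rgen, 'k) ncpoly set" where
  "traces m = {p. \<exists>q\<in>trace_span G n m. p \<approx> q}"

lemma trace_span_subspace: "np.subspace (trace_span G n m :: ('r rgen, 'k) ncpoly set)"
proof (rule np.subspaceI)
  show "0 \<in> trace_span G n m" using trace_span.zero by (simp add: np_eqs)
next
  fix p q :: "('r rgen, 'k) ncpoly" assume "p \<in> trace_span G n m" "q \<in> trace_span G n m"
  then show "p + q \<in> trace_span G n m"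
  proof induction
    case (step ls p c)
    then have "npadd (npscale c (trprod n ls)) (p + q) \<in> trace_span G n m" by (intro trace_span.step)
    then show ?case by (simp add: np_eqs plus_fun_def add.assoc)
  qed (simp add: np_eqs)
next
  fix c :: 'k and p :: "('r rgen, 'k) ncpoly" assume "p \<in> trace_span G n m"
  then show "npscale c p \<in> trace_span G n m"
  proof induction
    case (step ls p e)
    then have "npadd (npscale (c * e) (trprod n ls)) (npscale c p) \<in> trace_span G n m" by (intro trace_span.step)
    then show ?case by (simp add: np_eqs npscale_def plus_fun_def algebra_simps)
  qed (use trace_span.zero in \<open>simp add: np_eqs npscale_def zero_fun_def\<close>)
qed

lemma traces_subspace: "np.subspace (traces m)"
proof (rule np.subspaceI)
  show "0 \<in> traces m" using np.subspace_0[OF trace_span_subspace] by (auto simp: traces_def)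
next
  fix p q assume "p \<in> traces m" "q \<in> traces m"
  then show "p + q \<in> traces m"
    unfolding traces_def using equ_add np.subspace_add[OF trace_span_subspace] by blast
next
  fix c p assume "p \<in> traces m"
  then show "npscale c p \<in> traces m"
    unfolding traces_def using equ_scale np.subspace_scale[OF trace_span_subspace] by blast
qed

lemma traces_cong: "p \<approx> q \<Longrightarrow> q \<in> traces m \<Longrightarrow> p \<in> traces m"
  unfolding traces_def using equ_trans by blast

lemma one_in_traces: "npmon [] \<in> traces 0"
proof -
  have "npadd (npscale 1 (trprod n [])) npzero \<in> (trace_span G n 0 :: ('r rgen, 'k) ncpoly set)"
    by (intro trace_span.intros) auto
  then show ?thesis unfolding np_eqs trprod_def npprod_def np.scale_one by (auto simp: traces_def)
qed

lemma nptr_mult_in_traces: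
  assumes "p \<in> traces m" "r \<in> G a"
  shows "npmul (nptr n a r) p \<in> traces (a + m)"
proof -
  obtain q where q: "q \<in> trace_span G n m" "p \<approx> q" using assms by (auto simp: traces_def)
  have "nptr n a r \<in> (npPol V :: ('r rgen, 'k) ncpoly set)"
    unfolding nptr_def np_eqs
    by (rule np.subspace_sum[OF npPol_subspace npmon_in_npPol]) (use assms in \<open>auto simp: rvalid_def\<close>)
  with q(2) have "npmul (nptr n a r) p \<approx> npmul (nptr n a r) q" by (rule equ_npmul_left)
  moreover from q(1) have "npmul (nptr n a r) q \<in> trace_span G n (a + m)"
  proof induction
    case zero
    then show ?case using trace_span.zero by (simp add: npmul_def npzero_def)
  next
    case (step ls q c)
    then have "npadd (npscale c (trprod n ((a, r) # ls))) (npmul (nptr n a r) q) \<in> trace_span G n (a + m)"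
      using assms by (intro trace_span.step) auto
    also have "npadd (npscale c (trprod n ((a, r) # ls))) (npmul (nptr n a r) q) =
        npmul (nptr n a r) (npadd (npscale c (trprod n ls)) q)"
      by (simp add: np_eqs npmul_linear trprod_def npprod_def)
    finally show ?case .
  qed
  ultimately show ?thesis by (auto simp: traces_def)
qed

text \<open>Words with symbolic indices: \<open>\<beta>\<close> turns labels into matrix indices,
  and summing over all \<open>\<beta>\<close> contracts every label that occurs once as a row and
  once as a column. The label type is free because slots will serve as labels.\<close>

definition inst :: "('l \<Rightarrow> nat) \<Rightarrow> (int \<times> 'r \<times> 'l \<times> 'l) list \<Rightarrow> 'r rgen list" where
  "inst \<beta> = map (\<lambda>(m, r, a, b). (m, r, \<beta> a, \<beta> b))"

abbreviation lab1 :: "int \<times> 'r \<times> 'l \<times> 'l \<Rightarrow> 'l" where "lab1 x \<equiv> fst (snd (snd x))"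

abbreviation lab2 :: "int \<times> 'r \<times> 'l \<times> 'l \<Rightarrow> 'l" where "lab2 x \<equiv> snd (snd (snd x))"

lemma inst_simps [simp]:
  "inst \<beta> [] = []" "inst \<beta> ((m, r, a, b) # xs) = (m, r, \<beta> a, \<beta> b) # inst \<beta> xs"
  "inst \<beta> (xs @ ys) = inst \<beta> xs @ inst \<beta> ys"
  by (auto simp: inst_def)

lemma inst_cong:
  "(\<And>l. l \<in> lab1 ` set xs \<union> lab2 ` set xs \<Longrightarrow> \<beta> l = \<beta>' l) \<Longrightarrow> inst \<beta> xs = inst \<beta>' xs"
  unfolding inst_def by (intro map_cong refl) (force simp: case_prod_unfold)

lemma inst_valid:
  assumes "\<And>x. x \<in> set xs \<Longrightarrow> fst (snd x) \<in> G (fst x)"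
    and "\<And>l. l \<in> lab1 ` set xs \<union> lab2 ` set xs \<Longrightarrow> \<beta> l < n"
  shows "list_all V (inst \<beta> xs)"
  using assms by (auto simp: inst_def list_all_iff rvalid_def image_iff) (metis fst_conv snd_conv)+

text \<open>Either the first letter is closed up, and its trace splits off, or it is multiplied with
  the letter whose first label is its second one.\<close>

lemma contraction_in_traces:
  fixes xs :: "(int \<times> 'r \<times> 'l \<times> 'l) list"
  assumes "\<And>x. x \<in> set xs \<Longrightarrow> fst (snd x) \<in> G (fst x)"
    and "distinct (map lab1 xs)" "distinct (map lab2 xs)"
    and "L = lab1 ` set xs" "L = lab2 ` set xs"
  shows "(\<Sum>\<beta>\<in>Pi\<^sub>E L (\<lambda>_. {..<n}). npmon (inst \<beta> xs)) \<in> traces (sum_list (map fst xs))"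
  using assms
proof (induction "length xs" arbitrary: xs L rule: less_induct)
  case less
  show ?case
  proof (cases xs)
    case Nil
    then show ?thesis using less.prems one_in_traces by simp
  next
    case (Cons x ys)
    obtain m r a b where x: "x = (m, r, a, b)" by (cases x)
    note xs = Cons[unfolded x]
    have r: "r \<in> G m" using less.prems(1)[of x] Cons x by simp
    show ?thesis
    proof (cases "a = b")
      case True
      define L' where "L' = lab1 ` set ys"
      have a: "a \<notin> L'" using less.prems(2) xs by (auto simp: L'_def)
      have a': "a \<notin> lab2 ` set ys" using less.prems(3) xs True by auto
      have L: "L = insert a L'" using less.prems(4) xs by (auto simp: L'_def)
      have L': "L' = lab2 ` set ys"
        using less.prems(5) xs True a a' L by (auto simp: L'_def)
      have IH: "(\<Sum>\<beta>\<in>Pi\<^sub>E L' (\<lambda>_. {..<n}). npmon (inst \<beta> ys)) \<in> traces (sum_list (map fst ys))"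
        using less.prems xs L' by (intro less.hyps) (auto simp: L'_def)
      have "(\<Sum>\<beta>\<in>Pi\<^sub>E L (\<lambda>_. {..<n}). npmon (inst \<beta> xs)) =
          (\<Sum>z<n. \<Sum>\<beta>\<in>Pi\<^sub>E L' (\<lambda>_. {..<n}). npmon ((m, r, z, z) # inst \<beta> ys) :: ('r rgen, 'k) ncpoly)"
        unfolding L sum_PiE_insert[OF a]
      proof (intro sum.cong refl)
        fix z \<beta>
        have "inst (\<beta>(a := z)) ys = inst \<beta> ys" using a L' L'_def by (intro inst_cong) auto
        then show "npmon (inst (\<beta>(a := z)) xs) = (npmon ((m, r, z, z) # inst \<beta> ys) :: ('r rgen, 'k) ncpoly)"
          by (simp add: xs True)
      qed
      also have "\<dots> = npmul (nptr n m r) (\<Sum>\<beta>\<in>Pi\<^sub>E L' (\<lambda>_. {..<n}). npmon (inst \<beta> ys))"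
        by (simp add: nptr_def np_eqs npmul_sum_left npmul_sum_right npmul_npmon) (rule sum.swap)
      finally show ?thesis using nptr_mult_in_traces[OF IH r] xs by simp
    next
      case False
      have "b \<in> lab1 ` set ys" using less.prems(4,5) xs False by auto
      then obtain z where z: "z \<in> set ys" "lab1 z = b" by auto
      then obtain m' r' c where zz: "z = (m', r', b, c)" by (metis prod.collapse)
      from z(1) obtain bs cs where ys: "ys = bs @ z # cs" by (meson split_list)
      have r': "r' \<in> G m'" using less.prems(1)[of z] zz ys Cons by simp
      \<comment> \<open>Merging adds the two degrees and drops both occurrences of \<open>b\<close>,
        so the total degree and the agreement of the two label sets persist.\<close>
      define ws where "ws = (m + m', r * r', a, c) # bs @ cs"
      define L' where "L' = lab1 ` set ws"
      have b: "b \<notin> L'" using less.prems(2) False by (auto simp: xs ys zz L'_def ws_def)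
      have b': "b \<notin> lab2 ` set ws" using less.prems(3) by (auto simp: xs ys zz ws_def)
      have L: "L = insert b L'" using less.prems(4) by (auto simp: xs ys zz L'_def ws_def)
      have L2: "L = insert b (lab2 ` set ws)" using less.prems(5) by (auto simp: xs ys zz ws_def)
      have L': "L' = lab2 ` set ws" using L L2 b b' by auto
      have homog: "fst (snd x) \<in> G (fst x)" if "x \<in> set ws" for x
      proof -
        have "x = (m + m', r * r', a, c) \<or> x \<in> set xs" using that by (auto simp: xs ys ws_def)
        then show ?thesis using less.prems(1)[of x] mult_homogeneous[OF r r'] by (elim disjE) simp_all
      qed
      \<comment> \<open>The Koszul sign for moving the partner letter to the front past
        \<open>bs\<close>. It does not depend on \<open>\<beta>\<close>, so it leaves the sum as a
        common factor.\<close>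
      define s where "s = (prod_list (map (\<lambda>b. ksign (fst b) m') bs) :: 'k)"
      have merge: "(\<Sum>z<n. npmon (inst (\<beta>(b := z)) xs)) \<approx> npscale s (npmon (inst \<beta> ws))"
        if \<beta>: "\<beta> \<in> Pi\<^sub>E L' (\<lambda>_. {..<n})" for \<beta>
      proof -
        have lt: "\<beta> l < n" if "l \<in> lab1 ` set ws \<union> lab2 ` set ws" for l
          using \<beta> that L' L'_def by auto
        have ac: "\<beta> a < n" "\<beta> c < n" by (auto intro!: lt simp: ws_def)
        have "list_all V (inst \<beta> ws)" by (rule inst_valid[OF homog lt])
        then have val: "list_all V (inst \<beta> bs)" "list_all V (inst \<beta> cs)" by (auto simp: ws_def)
        have "(\<Sum>z<n. npmon (inst (\<beta>(b := z)) xs)) =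
            (\<Sum>z<n. npmon ([(m, r, \<beta> a, z)] @ inst \<beta> bs @ (m', r', z, \<beta> c) # inst \<beta> cs) :: ('r rgen, 'k) ncpoly)"
        proof (intro sum.cong refl)
          fix z
          have "b \<notin> lab1 ` set bs \<union> lab2 ` set bs" "b \<notin> lab1 ` set cs \<union> lab2 ` set cs"
            using b b' unfolding L'_def ws_def by (simp_all add: image_Un)
          then have "inst (\<beta>(b := z)) bs = inst \<beta> bs" "inst (\<beta>(b := z)) cs = inst \<beta> cs"
            by (intro inst_cong fun_upd_other; blast)+
          moreover have "c \<noteq> b" using b' by (auto simp: ws_def)
          ultimately show "npmon (inst (\<beta>(b := z)) xs) =
              (npmon ([(m, r, \<beta> a, z)] @ inst \<beta> bs @ (m', r', z, \<beta> c) # inst \<beta> cs) :: ('r rgen, 'k) ncpoly)"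
            using False by (simp add: xs ys zz)
        qed
        also have "\<dots> \<approx> (\<Sum>z<n. npscale s (npmon ([(m, r, \<beta> a, z)] @ (m', r', z, \<beta> c) # inst \<beta> bs @ inst \<beta> cs)))"
        proof (intro equ_sum)
          fix z assume "z \<in> {..<n}"
          then have "V (m', r', z, \<beta> c)" "list_all V [(m, r, \<beta> a, z)]"
            using r r' ac by (auto simp: rvalid_def)
          from equ_move[OF this val]
          show "npmon ([(m, r, \<beta> a, z)] @ inst \<beta> bs @ (m', r', z, \<beta> c) # inst \<beta> cs) \<approx>
              npscale s (npmon ([(m, r, \<beta> a, z)] @ (m', r', z, \<beta> c) # inst \<beta> bs @ inst \<beta> cs))"
            by (simp add: s_def inst_def rdeg_def case_prod_unfold comp_def)
        qed
        also have "\<dots> = npscale s (\<Sum>z<n. npmon ([] @ (m, r, \<beta> a, z) # (m', r', z, \<beta> c) # inst \<beta> bs @ inst \<beta> cs))"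
          by (simp add: np.scale_sum_right)
        also have "\<dots> \<approx> npscale s (npmon ([] @ (m + m', r * r', \<beta> a, \<beta> c) # inst \<beta> bs @ inst \<beta> cs))"
          by (intro equ_scale equ_mult r r' ac) (use val in auto)
        finally show ?thesis by (simp add: ws_def)
      qed
      have IH: "(\<Sum>\<beta>\<in>Pi\<^sub>E L' (\<lambda>_. {..<n}). npmon (inst \<beta> ws)) \<in> traces (sum_list (map fst ws))"
      proof (rule less.hyps[OF _ homog])
        show "length ws < length xs" by (simp add: xs ys ws_def)
        show "distinct (map lab1 ws)" "distinct (map lab2 ws)"
          using less.prems(2,3) by (auto simp: xs ys zz ws_def)
        show "L' = lab1 ` set ws" "L' = lab2 ` set ws" by (fact L'_def, fact L')
      qed
      have "(\<Sum>\<beta>\<in>Pi\<^sub>E L (\<lambda>_. {..<n}). npmon (inst \<beta> xs)) =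
          (\<Sum>\<beta>\<in>Pi\<^sub>E L' (\<lambda>_. {..<n}). \<Sum>z<n. npmon (inst (\<beta>(b := z)) xs) :: ('r rgen, 'k) ncpoly)"
        unfolding L sum_PiE_insert[OF b] by (rule sum.swap)
      also have "\<dots> \<approx> npscale s (\<Sum>\<beta>\<in>Pi\<^sub>E L' (\<lambda>_. {..<n}). npmon (inst \<beta> ws))"
        unfolding np.scale_sum_right by (intro equ_sum merge)
      finally have "(\<Sum>\<beta>\<in>Pi\<^sub>E L (\<lambda>_. {..<n}). npmon (inst \<beta> xs)) \<in> traces (sum_list (map fst ws))"
        using np.subspace_scale[OF traces_subspace IH] by (rule traces_cong)
      then show ?thesis by (simp add: ws_def xs ys zz algebra_simps)
    qed
  qed
qed

end

subsection \<open>The determinant and the adjugate as polynomials in the matrix entries\<close>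

definition ndet :: "nat \<Rightarrow> (nat \<Rightarrow> nat \<Rightarrow> 'a::comm_ring_1) \<Rightarrow> 'a" where
  "ndet n g = (\<Sum>p | p permutes {..<n}. of_int (sign p) * (\<Prod>s<n. g s (p s)))"

text \<open>Entry \<open>(b, j)\<close> of the adjugate. Constraining permutations of the full index
  set, instead of passing to a minor, lets words expand over the same families as det^M.\<close>

definition nadj :: "nat \<Rightarrow> (nat \<Rightarrow> nat \<Rightarrow> 'a::comm_ring_1) \<Rightarrow> nat \<Rightarrow> nat \<Rightarrow> 'a" where
  "nadj n g b j = (\<Sum>p | p permutes {..<n}.
     if p j = b then of_int (sign p) * (\<Prod>s\<in>{..<n} - {j}. g s (p s)) else 0)"

text \<open>The entry of row \<open>i\<close> fills the gap that the cofactor leaves in row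
  \<open>j\<close>. For \<open>i = j\<close> this is the Leibniz formula; otherwise row
  \<open>i\<close> is used twice and a transposition cancels the terms in pairs.\<close>

lemma row_mult_nadj:
  fixes g :: "nat \<Rightarrow> nat \<Rightarrow> 'a::field_char_0"
  assumes "i < n" "j < n"
  shows "(\<Sum>b<n. g i b * nadj n g b j) = (if i = j then ndet n g else 0)"
proof -
  let ?P = "{p. p permutes {..<n}}"
  define T where "T p = of_int (sign p) * (g i (p j) * (\<Prod>s\<in>{..<n} - {j}. g s (p s)))" for p :: "nat \<Rightarrow> nat"
  have "(\<Sum>b<n. g i b * nadj n g b j) = (\<Sum>b<n. \<Sum>p\<in>?P. if b = p j then T p else 0)"
    unfolding nadj_def sum_distrib_left by (intro sum.cong refl) (auto simp: T_def)
  also have "\<dots> = (\<Sum>p\<in>?P. \<Sum>b<n. if b = p j then T p else 0)" by (rule sum.swap)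
  also have "\<dots> = sum T ?P"
  proof (intro sum.cong refl)
    fix p assume "p \<in> ?P"
    then have "p j < n" using permutes_in_image[of p "{..<n}" j] assms by simp
    then show "(\<Sum>b<n. if b = p j then T p else 0) = T p" by simp
  qed
  also have "\<dots> = (if i = j then ndet n g else 0)"
  proof (cases "i = j")
    case True
    then show ?thesis unfolding ndet_def T_def
      using assms by (simp add: prod.remove[of "{..<n}" j])
  next
    case False
    have tr: "transpose i j permutes {..<n}" using assms by (intro permutes_swap_id) auto
    have "T (p \<circ> transpose i j) = - T p" if "p \<in> ?P" for p
    proof -
      have "sign (p \<circ> transpose i j) = - sign p"
        using that False sign_compose_permutes[OF _ tr, of p] by (simp add: sign_swap_id)
      moreover have "(\<Prod>s\<in>{..<n} - {j}. g s (h s)) = g i (h i) * (\<Prod>s\<in>{..<n} - {j} - {i}. g s (h s))" for h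
        using assms False by (subst prod.remove[of _ i]) auto
      moreover have "(\<Prod>s\<in>{..<n} - {j} - {i}. g s ((p \<circ> transpose i j) s)) = (\<Prod>s\<in>{..<n} - {j} - {i}. g s (p s))"
        by (intro prod.cong) (auto simp: transpose_def)
      ultimately show ?thesis by (simp add: T_def mult_ac)
    qed
    moreover have "sum T ?P = (\<Sum>p\<in>?P. T (p \<circ> transpose i j))"
      by (rule sum.reindex_bij_witness[where i = "\<lambda>p. p \<circ> transpose i j" and j = "\<lambda>p. p \<circ> transpose i j"])
        (auto simp: comp_assoc intro!: permutes_compose tr)
    ultimately have "sum T ?P = - sum T ?P" by (simp add: sum_negf)
    then show ?thesis using False by simp
  qed
  finally show ?thesis .
qed

lemma inv_pair_nadj:
  fixes g :: "nat \<Rightarrow> nat \<Rightarrow> 'a::field_char_0"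
  assumes "ndet n g \<noteq> 0"
  shows "inv_pair n g (\<lambda>b j. inverse (ndet n g) * nadj n g b j)"
proof -
  define h where "h b j = inverse (ndet n g) * nadj n g b j" for b j
  define A where "A = mat n n (\<lambda>(i, j). g i j)"
  define B where "B = mat n n (\<lambda>(i, j). h i j)"
  have AB_carrier: "A \<in> carrier_mat n n" "B \<in> carrier_mat n n" by (auto simp: A_def B_def)
  have gh: "(\<Sum>l<n. g i l * h l j) = (if i = j then 1 else 0)" if "i < n" "j < n" for i j
  proof -
    have "(\<Sum>l<n. g i l * h l j) = inverse (ndet n g) * (\<Sum>l<n. g i l * nadj n g l j)"
      by (simp add: h_def sum_distrib_left mult_ac)
    then show ?thesis using row_mult_nadj[OF that, of g] assms by simp
  qed
  have "A * B = 1\<^sub>m n"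
    by (rule eq_matI) (auto simp: A_def B_def scalar_prod_def gh simp flip: lessThan_atLeast0)
  \<comment> \<open>The row expansion yields a right inverse only, while \<open>inv_pair\<close>
    asks for both sides.\<close>
  then have BA: "B * A = 1\<^sub>m n" by (rule mat_mult_left_right_inverse[OF AB_carrier])
  have hg: "(\<Sum>l<n. h i l * g l j) = (if i = j then 1 else 0)" if "i < n" "j < n" for i j
  proof -
    have "(B * A) $$ (i, j) = (\<Sum>l<n. h i l * g l j)"
      using that by (simp add: A_def B_def scalar_prod_def lessThan_atLeast0)
    then show ?thesis using BA that by simp
  qed
  show ?thesis unfolding inv_pair_def h_def[symmetric] using gh hg by blast
qed

section \<open>Expansion of determinant powers and of transformed words over the slots\<close>

lemma ndet_power:
  fixes g :: "nat \<Rightarrow> nat \<Rightarrow> 'a::comm_ring_1"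
  shows "ndet n g ^ M =
    (\<Sum>\<tau>\<in>perm_fams M n. fam_sign M \<tau> * (\<Prod>q\<in>{..<M} \<times> {..<n}. g (snd q) (fam_app \<tau> q)))"
proof -
  have "ndet n g ^ M = (\<Prod>t<M. \<Sum>p | p permutes {..<n}. of_int (sign p) * (\<Prod>s<n. g s (p s)))"
    by (simp add: ndet_def)
  also have "\<dots> = (\<Sum>\<tau>\<in>perm_fams M n. \<Prod>t<M. of_int (sign (\<tau> t)) * (\<Prod>s<n. g s (\<tau> t s)))"
    unfolding perm_fams_def by (rule prod_sum_PiE) (auto simp: finite_permutations)
  finally show ?thesis
    by (simp add: prod.distrib fam_sign_def fam_app_def prod.cartesian_product case_prod_unfold)
qed

text \<open>A permutation \<open>p\<close> occurs in the cofactor for exactly one \<open>b\<close>,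
  namely \<open>p j\<close>. The sum over \<open>b\<close> therefore disappears and
  \<open>p j\<close> becomes the new column index.\<close>

lemma glact_nadj:
  fixes g :: "nat \<Rightarrow> nat \<Rightarrow> 'k::field_char_0"
  assumes "j < n"
  shows "glact n g (nadj n g) (m, r, i, j) = (\<Sum>z\<in>{..<n} \<times> {p. p permutes {..<n}}.
    npscale (of_int (sign (snd z)) * (g i (fst z) * (\<Prod>s\<in>{..<n} - {j}. g s (snd z s))))
      (npmon [(m, r, fst z, snd z j)]))"
proof -
  let ?P = "{p. p permutes {..<n}}"
  define c where "c a p = of_int (sign p) * (g i a * (\<Prod>s\<in>{..<n} - {j}. g s (p s)))" for a and p :: "nat \<Rightarrow> nat"
  have "glact n g (nadj n g) (m, r, i, j) =
      (\<Sum>a<n. \<Sum>b<n. npscale (g i a * nadj n g b j) (npmon [(m, r, a, b)]))"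
    by (simp add: glact_def np_eqs sum.cartesian_product case_prod_unfold)
  also have "\<dots> = (\<Sum>a<n. \<Sum>b<n. \<Sum>p\<in>?P. if b = p j then npscale (c a p) (npmon [(m, r, a, p j)]) else 0)"
  proof (intro sum.cong refl)
    fix a b
    have "g i a * nadj n g b j = (\<Sum>p\<in>?P. if b = p j then c a p else 0)"
      unfolding nadj_def sum_distrib_left by (intro sum.cong) (auto simp: c_def)
    then show "npscale (g i a * nadj n g b j) (npmon [(m, r, a, b)]) =
        (\<Sum>p\<in>?P. if b = p j then npscale (c a p) (npmon [(m, r, a, p j)]) else 0 :: ('a rgen, 'k) ncpoly)"
      by (simp only: np.scale_sum_left) (rule sum.cong; simp)
  qed
  also have "\<dots> = (\<Sum>a<n. \<Sum>p\<in>?P. npscale (c a p) (npmon [(m, r, a, p j)]))"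
  proof (intro sum.cong refl)
    fix a
    have "(\<Sum>b<n. \<Sum>p\<in>?P. if b = p j then npscale (c a p) (npmon [(m, r, a, p j)]) else 0 :: ('a rgen, 'k) ncpoly)
        = (\<Sum>p\<in>?P. \<Sum>b<n. if b = p j then npscale (c a p) (npmon [(m, r, a, p j)]) else 0)" by (rule sum.swap)
    also have "\<dots> = (\<Sum>p\<in>?P. npscale (c a p) (npmon [(m, r, a, p j)]))"
    proof (intro sum.cong refl)
      fix p assume "p \<in> ?P"
      then have "p j < n" using permutes_in_image[of p "{..<n}" j] assms by simp
      then show "(\<Sum>b<n. if b = p j then npscale (c a p) (npmon [(m, r, a, p j)]) else 0) =
          (npscale (c a p) (npmon [(m, r, a, p j)]) :: ('a rgen, 'k) ncpoly)"
        by (subst sum.delta) auto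
    qed
    finally show "(\<Sum>b<n. \<Sum>p\<in>?P. if b = p j then npscale (c a p) (npmon [(m, r, a, p j)]) else 0 :: ('a rgen, 'k) ncpoly)
        = (\<Sum>p\<in>?P. npscale (c a p) (npmon [(m, r, a, p j)]))" .
  qed
  finally show ?thesis by (simp add: sum.cartesian_product case_prod_unfold c_def)
qed

text \<open>Block \<open>t\<close> consists of the slots \<open>(t, s)\<close>, \<open>s < n\<close>. The cofactor coming from the letter
  \<open>(m, r, i, j)\<close> in position \<open>t\<close> of a word leaves the slot \<open>(t, j)\<close> free; it is filled by the entry
  with row \<open>i\<close> that acts on the first index.\<close>

definition letter_row :: "'r rgen list \<Rightarrow> nat \<Rightarrow> nat" where "letter_row v t = fst (snd (snd (v ! t)))"

definition letter_col :: "'r rgen list \<Rightarrow> nat \<Rightarrow> nat" where "letter_col v t = snd (snd (snd (v ! t)))"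

definition slot_row :: "'r rgen list \<Rightarrow> nat \<times> nat \<Rightarrow> nat" where
  "slot_row v q = (if snd q = letter_col v (fst q) then letter_row v (fst q) else snd q)"

definition slot_col :: "'r rgen list \<Rightarrow> (nat \<Rightarrow> nat) \<Rightarrow> (nat \<Rightarrow> nat \<Rightarrow> nat) \<Rightarrow> nat \<times> nat \<Rightarrow> nat" where
  "slot_col v a \<tau> q = (if snd q = letter_col v (fst q) then a (fst q) else fam_app \<tau> q)"

definition reindex_word :: "'r rgen list \<Rightarrow> (nat \<Rightarrow> nat) \<Rightarrow> (nat \<Rightarrow> nat) \<Rightarrow> 'r rgen list" where
  "reindex_word v a b = map (\<lambda>t. (fst (v ! t), fst (snd (v ! t)), a t, b t)) [0..<length v]"

text \<open>Each letter has degree \<open>n\<close> in \<open>g\<close>: one entry from the left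
  factor and \<open>n - 1\<close> from the cofactor. The product thus has one entry per slot, just
  as in \<open>ndet_power\<close>, and both can be polarized over the same set.\<close>

lemma npprod_glact_nadj:
  fixes g :: "nat \<Rightarrow> nat \<Rightarrow> 'k::field_char_0"
  assumes "list_all (rvalid G n) v" "length v = M"
  shows "npprod (map (glact n g (nadj n g)) v) =
    (\<Sum>a\<in>Pi\<^sub>E {..<M} (\<lambda>_. {..<n}). \<Sum>\<tau>\<in>perm_fams M n.
      npscale (fam_sign M \<tau> * (\<Prod>q\<in>{..<M} \<times> {..<n}. g (slot_row v q) (slot_col v a \<tau> q)))
        (npmon (reindex_word v a (\<lambda>t. \<tau> t (letter_col v t)))))"
proof -
  let ?Z = "{..<n} \<times> {p. p permutes {..<n}}"
  define c where "c t z = of_int (sign (snd z)) * (g (letter_row v t) (fst z) *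
    (\<Prod>s\<in>{..<n} - {letter_col v t}. g s (snd z s)))" for t and z :: "nat \<times> (nat \<Rightarrow> nat)"
  define y where "y t z = (fst (v ! t), fst (snd (v ! t)), fst z, snd z (letter_col v t))"
    for t and z :: "nat \<times> (nat \<Rightarrow> nat)"
  have col: "letter_col v t < n" if "t < M" for t
  proof -
    have "rvalid G n (v ! t)" using assms that by (auto simp: list_all_length)
    then show ?thesis by (auto simp: rvalid_def letter_col_def)
  qed
  have letter: "glact n g (nadj n g) (v ! t) = (\<Sum>z\<in>?Z. npscale (c t z) (npmon [y t z]))" if "t < M" for t
    using glact_nadj[OF col[OF that], of g "fst (v ! t)" "fst (snd (v ! t))" "letter_row v t"]
    by (simp add: c_def y_def letter_row_def letter_col_def)
  have v: "v = map ((!) v) [0..<M]" using map_nth[of v] assms(2) by simp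
  have "npprod (map (glact n g (nadj n g)) v) =
      foldr npmul (map (\<lambda>t. glact n g (nadj n g) (v ! t)) [0..<M]) (npmon [])"
    by (subst v) (simp add: npprod_def np_eqs comp_def del: map_nth)
  also have "\<dots> = (\<Sum>\<zeta>\<in>Pi\<^sub>E {..<M} (\<lambda>_. ?Z). npscale (\<Prod>t<M. c t (\<zeta> t)) (npmon (map (\<lambda>t. y t (\<zeta> t)) [0..<M] @ [])))"
    by (rule foldr_npmul_expand[OF letter])
  also have "\<dots> = (\<Sum>a\<in>Pi\<^sub>E {..<M} (\<lambda>_. {..<n}). \<Sum>\<tau>\<in>perm_fams M n.
      npscale (\<Prod>t<M. c t (a t, \<tau> t)) (npmon (map (\<lambda>t. y t (a t, \<tau> t)) [0..<M])))"
    unfolding sum_PiE_Times perm_fams_def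
    by (intro sum.cong refl arg_cong2[of _ _ _ _ npscale] arg_cong[of _ _ npmon] prod.cong) auto
  also have "\<dots> = (\<Sum>a\<in>Pi\<^sub>E {..<M} (\<lambda>_. {..<n}). \<Sum>\<tau>\<in>perm_fams M n.
      npscale (fam_sign M \<tau> * (\<Prod>q\<in>{..<M} \<times> {..<n}. g (slot_row v q) (slot_col v a \<tau> q)))
        (npmon (reindex_word v a (\<lambda>t. \<tau> t (letter_col v t)))))"
  proof (intro sum.cong refl arg_cong2[of _ _ _ _ npscale] arg_cong[of _ _ npmon])
    fix a \<tau>
    have "(\<Prod>s<n. g (slot_row v (t, s)) (slot_col v a \<tau> (t, s))) =
        g (letter_row v t) (a t) * (\<Prod>s\<in>{..<n} - {letter_col v t}. g s (\<tau> t s))" if "t < M" for t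
    proof -
      have "(\<Prod>s\<in>{..<n} - {letter_col v t}. g (slot_row v (t, s)) (slot_col v a \<tau> (t, s))) =
          (\<Prod>s\<in>{..<n} - {letter_col v t}. g s (\<tau> t s))"
        by (intro prod.cong) (auto simp: slot_row_def slot_col_def fam_app_def)
      then show ?thesis
        using col[OF that] by (simp add: prod.remove[of "{..<n}" "letter_col v t"] slot_row_def slot_col_def)
    qed
    then have "(\<Prod>t<M. c t (a t, \<tau> t)) =
        (\<Prod>t<M. of_int (sign (\<tau> t)) * (\<Prod>s<n. g (slot_row v (t, s)) (slot_col v a \<tau> (t, s))))"
      by (intro prod.cong) (auto simp: c_def)
    then show "(\<Prod>t<M. c t (a t, \<tau> t)) =
        fam_sign M \<tau> * (\<Prod>q\<in>{..<M} \<times> {..<n}. g (slot_row v q) (slot_col v a \<tau> q))"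
      by (simp add: prod.distrib fam_sign_def prod.cartesian_product case_prod_unfold)
    show "map (\<lambda>t. y t (a t, \<tau> t)) [0..<M] = reindex_word v a (\<lambda>t. \<tau> t (letter_col v t))"
      using assms by (simp add: reindex_word_def y_def)
  qed
  finally show ?thesis .
qed

lemma glact_scale: "glact n g (\<lambda>b j. c * h b j) x = npscale c (glact n g h x)"
  by (cases x) (simp add: glact_def np_eqs np.scale_sum_right case_prod_unfold mult_ac)

lemma npprod_glact_scale:
  "npprod (map (glact n g (\<lambda>b j. c * h b j)) v) = npscale (c ^ length v) (npprod (map (glact n g h) v))"
  by (induction v) (simp_all add: npprod_def np_eqs glact_scale npmul_linear mult_ac)

text \<open>The left-hand side is written in the form that arises when \<open>g i j\<close> is the
  number of \<open>s\<close> in \<open>S\<close> with \<open>(i, j) = y0 s\<close>.\<close>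

lemma polarized_sum:
  fixes y0 :: "'q \<Rightarrow> nat \<times> nat" and v :: "'a \<Rightarrow> ('x, 'k::field) ncpoly"
  assumes Q: "finite Q"
  shows "(\<Sum>S\<in>Pow Q. npscale ((- 1) ^ card (Q - S)) (\<Sum>a\<in>A. npscale (c a *
        (\<Prod>q\<in>Q. \<Sum>s\<in>S. if (fst (y a q), snd (y a q)) = y0 s then 1 else 0)) (v a))) =
      (\<Sum>a\<in>A. npscale (c a * of_nat (card {\<pi>. \<pi> permutes Q \<and> (\<forall>q\<in>Q. y a q = y0 (\<pi> q))})) (v a))"
proof -
  let ?g = "\<lambda>S a q. \<Sum>s\<in>S. if y a q = y0 s then 1 else 0 :: 'k"
  have "(\<Sum>S\<in>Pow Q. npscale ((- 1) ^ card (Q - S)) (\<Sum>a\<in>A. npscale (c a * (\<Prod>q\<in>Q. ?g S a q)) (v a))) =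
      (\<Sum>S\<in>Pow Q. \<Sum>a\<in>A. npscale (c a * ((- 1) ^ card (Q - S) * (\<Prod>q\<in>Q. ?g S a q))) (v a))"
    by (simp only: np.scale_sum_right np.scale_scale mult.left_commute)
  also have "\<dots> = (\<Sum>a\<in>A. npscale (c a * (\<Sum>S\<in>Pow Q. (- 1) ^ card (Q - S) * (\<Prod>q\<in>Q. ?g S a q))) (v a))"
    by (subst sum.swap) (simp only: sum_distrib_left np.scale_sum_left)
  finally show ?thesis by (simp only: polarization_count[OF Q] prod.collapse)
qed

section \<open>Unit padding and invariance for all matrices\<close>

context graded_rep begin

lemma glact_in_npPol: "V x \<Longrightarrow> glact n g h x \<in> npPol V"
  by (cases x, simp only: glact_def prod.case np_eqs)
    (rule np.subspace_sum[OF npPol_subspace], auto simp: rvalid_def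
      intro!: np.subspace_scale[OF npPol_subspace] npmon_in_npPol)

text \<open>Since pi(1) is the identity matrix, the transformed letter is the entry of g h at
  \<open>(0, 0)\<close>. For the adjugate this is the determinant.\<close>

lemma glact_unit_letter:
  assumes "0 < n" "(\<Sum>l<n. g 0 l * h l 0) = D"
  shows "glact n g h (0, 1, 0, 0) \<approx> npscale D (npmon [])"
proof -
  have "glact n g h (0, 1, 0, 0) = (\<Sum>a<n. \<Sum>b<n. npscale (g 0 a * h b 0) (npmon ([] @ (0, 1, a, b) # [])))"
    by (simp add: glact_def np_eqs sum.cartesian_product case_prod_unfold)
  also have "\<dots> \<approx> (\<Sum>a<n. \<Sum>b<n. npscale (g 0 a * h b 0) (if a = b then npmon ([] @ []) else 0))"
    by (intro equ_sum equ_scale equ_unit) auto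
  also have "\<dots> = (\<Sum>a<n. \<Sum>b<n. if a = b then npscale (g 0 a * h b 0) (npmon []) else 0)"
    by (intro sum.cong refl) auto
  also have "\<dots> = (\<Sum>a<n. npscale (g 0 a * h a 0) (npmon []))"
    by (intro sum.cong refl) (subst sum.delta', auto)
  also have "\<dots> = npscale D (npmon [])" by (simp only: assms(2)[symmetric] np.scale_sum_left)
  finally show ?thesis .
qed

lemma glact_pad:
  assumes "0 < n" "list_all V u" "(\<Sum>l<n. g 0 l * h l 0) = D"
  shows "npprod (map (glact n g h) (u @ replicate k (0, 1, 0, 0))) \<approx>
    npscale (D ^ k) (npprod (map (glact n g h) u))"
proof -
  let ?e = "(0, 1, 0, 0) :: 'r rgen"
  have e: "V ?e" using assms(1) one_homogeneous by (simp add: rvalid_def)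
  have "npprod (map (glact n g h) (replicate k ?e)) \<approx> npscale (D ^ k) (npmon [])"
  proof (induction k)
    case (Suc k)
    have "npprod (map (glact n g h) (replicate (Suc k) ?e)) =
        npmul (glact n g h ?e) (npprod (map (glact n g h) (replicate k ?e)))"
      by (simp add: npprod_def)
    also have "\<dots> \<approx> npmul (glact n g h ?e) (npscale (D ^ k) (npmon []))"
      by (rule equ_npmul_left[OF Suc.IH glact_in_npPol[OF e]])
    also have "\<dots> = npscale (D ^ k) (glact n g h ?e)" by (simp add: npmul_linear npmul_one_right)
    also have "\<dots> \<approx> npscale (D ^ k) (npscale D (npmon []))"
      by (rule equ_scale[OF glact_unit_letter[where g = g and h = h, OF assms(1,3)]])
    finally show ?case by (simp add: mult.commute)
  qed (simp add: npprod_def np_eqs)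
  moreover have "foldr npmul (map (glact n g h) u) p \<approx> foldr npmul (map (glact n g h) u) q" if "p \<approx> q" for p q
    using assms(2) that by (induction u) (auto intro: equ_npmul_left glact_in_npPol)
  ultimately have "foldr npmul (map (glact n g h) u) (npprod (map (glact n g h) (replicate k ?e))) \<approx>
      foldr npmul (map (glact n g h) u) (npscale (D ^ k) (npmon []))" by blast
  then show ?thesis by (simp add: npprod_def np_eqs foldr_npmul_linear)
qed

text \<open>Padding by at least one unit letter makes both sides vanish when \<open>g\<close> is singular.\<close>

lemma invariance_all_matrices:
  assumes n: "0 < n" and p: "p \<in> npPol V"
    and inv: "\<And>g h. inv_pair n g h \<Longrightarrow> npsubst (glact n g h) p \<approx> p"
    and M: "\<And>u. p u \<noteq> 0 \<Longrightarrow> length u < M"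
  shows "(\<Sum>u | p u \<noteq> 0. npscale (p u)
      (npprod (map (glact n g (nadj n g)) (u @ replicate (M - length u) (0, 1, 0, 0))))) \<approx>
    npscale (ndet n g ^ M) p"
proof -
  let ?D = "ndet n g"
  let ?W = "\<lambda>h u. npprod (map (glact n g h) u)"
  have val: "list_all V u" if "p u \<noteq> 0" for u using p that by (auto simp: npPol_def list_all_iff)
  have "(\<Sum>l<n. g 0 l * nadj n g l 0) = ?D" using row_mult_nadj[of 0 n 0 g] n by simp
  then have pad: "?W (nadj n g) (u @ replicate (M - length u) (0, 1, 0, 0)) \<approx>
      npscale (?D ^ (M - length u)) (?W (nadj n g) u)" if "p u \<noteq> 0" for u
    using glact_pad[OF n val[OF that]] by blast
  show ?thesis
  proof (cases "?D = 0")
    case True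
    have 0: "npscale (?D ^ M) p = 0"
    \<comment> \<open>The power with exponent 0 is 1 even when the determinant vanishes; but then no
      word is shorter than \<open>M\<close>, so \<open>p\<close> is 0.\<close>
    proof (cases "M = 0")
      case True
      then have "p = 0" using M by (auto simp: fun_eq_iff)
      then show ?thesis by simp
    qed (use True in simp)
    have "(\<Sum>u | p u \<noteq> 0. npscale (p u)
        (?W (nadj n g) (u @ replicate (M - length u) (0, 1, 0, 0)))) \<approx> (\<Sum>u | p u \<noteq> 0. npscale (p u) 0)"
    proof (intro equ_sum equ_scale)
      fix u assume "u \<in> {u. p u \<noteq> 0}"
      then have "?D ^ (M - length u) = 0" and "p u \<noteq> 0" using M[of u] True by auto
      then show "?W (nadj n g) (u @ replicate (M - length u) (0, 1, 0, 0)) \<approx> 0"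
        using pad[of u] by (simp only: np.scale_zero_left not_False_eq_True)
    qed
    also have "\<dots> = npscale (?D ^ M) p" unfolding 0 by simp
    finally show ?thesis .
  next
    case False
    define h where "h b j = inverse ?D * nadj n g b j" for b j
    have adj: "nadj n g = (\<lambda>b j. ?D * h b j)" using False by (auto simp: h_def fun_eq_iff)
    have ip: "inv_pair n g h" using inv_pair_nadj[OF False] unfolding h_def .
    have "(\<Sum>u | p u \<noteq> 0. npscale (p u) (?W (nadj n g) (u @ replicate (M - length u) (0, 1, 0, 0)))) \<approx>
        (\<Sum>u | p u \<noteq> 0. npscale (p u) (npscale (?D ^ (M - length u)) (?W (nadj n g) u)))"
      by (intro equ_sum equ_scale) (use pad in auto)
    also have "\<dots> = (\<Sum>u | p u \<noteq> 0. npscale (?D ^ M) (npscale (p u) (?W h u)))"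
    proof (intro sum.cong refl)
      fix u assume "u \<in> {u. p u \<noteq> 0}"
      then have "?D ^ (M - length u) * ?D ^ length u = ?D ^ M" using M[of u] by (simp flip: power_add)
      moreover have "?W (nadj n g) u = npscale (?D ^ length u) (?W h u)"
        unfolding adj by (rule npprod_glact_scale)
      ultimately show "npscale (p u) (npscale (?D ^ (M - length u)) (?W (nadj n g) u)) =
          npscale (?D ^ M) (npscale (p u) (?W h u))"
        by (simp add: mult_ac)
    qed
    also have "\<dots> = npscale (?D ^ M) (npsubst (glact n g h) p)"
      by (simp add: np.scale_sum_right npsubst_def npscale_def fun_eq_iff sum_fun_apply sum_distrib_left)
    also have "\<dots> \<approx> npscale (?D ^ M) p" by (rule equ_scale[OF inv[OF ip]])
    finally show ?thesis .
  qed
qed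

text \<open>The assumption is used at the finitely many matrices attached to the subsets of
  \<open>Q\<close>. Congruence survives their signed combination, and the result compares single
  polarized coefficients modulo the ideal.\<close>

lemma equ_polarize:
  assumes Q: "finite Q"
    and F: "\<And>g :: nat \<Rightarrow> nat \<Rightarrow> 'k.
      (\<Sum>a\<in>A. npscale (c a * (\<Prod>q\<in>Q. g (fst (y a q)) (snd (y a q)))) (v a)) \<approx>
      (\<Sum>b\<in>B. npscale (d b * (\<Prod>q\<in>Q. g (fst (z b q)) (snd (z b q)))) (w b))"
  shows "(\<Sum>a\<in>A. npscale (c a * of_nat (card {\<pi>. \<pi> permutes Q \<and> (\<forall>q\<in>Q. y a q = y0 (\<pi> q))})) (v a)) \<approx>
    (\<Sum>b\<in>B. npscale (d b * of_nat (card {\<pi>. \<pi> permutes Q \<and> (\<forall>q\<in>Q. z b q = y0 (\<pi> q))})) (w b))"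
  unfolding polarized_sum[OF Q, symmetric] by (intro equ_sum equ_scale F)

subsection \<open>The first fundamental theorem\<close>

text \<open>Entries of pi(1) act as Kronecker deltas; read backwards, this turns conditions on
  indices into letters.\<close>

lemma equ_unit_letters:
  assumes "list_all V w" "\<And>q. q \<in> set qs \<Longrightarrow> \<alpha> q < n \<and> \<beta> q < n"
  shows "npmon (w @ map (\<lambda>q. (0, 1, \<alpha> q, \<beta> q)) qs) \<approx> (if \<forall>q\<in>set qs. \<alpha> q = \<beta> q then npmon w else 0)"
  using assms(2)
proof (induction qs)
  case (Cons q qs)
  have "npmon (w @ map (\<lambda>q. (0, 1, \<alpha> q, \<beta> q)) (q # qs)) \<approx>
      (if \<alpha> q = \<beta> q then npmon (w @ map (\<lambda>q. (0, 1, \<alpha> q, \<beta> q)) qs) else 0)"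
    unfolding list.map(2)
    by (rule equ_unit) (use Cons.prems assms(1) one_homogeneous in \<open>auto simp: list_all_iff rvalid_def\<close>)
  also have "\<dots> \<approx> (if \<forall>q'\<in>set (q # qs). \<alpha> q' = \<beta> q' then npmon w else 0)"
    using Cons.IH Cons.prems by (auto split: if_splits)
  finally show ?case .
qed simp

text \<open>The coefficient of \<open>F\<close> picked out by polarization, for one word: filling all slots with
  unit letters turns it into a combination of full contractions.\<close>

lemma polarized_word_in_traces:
  fixes v :: "'r rgen list"
  defines "M \<equiv> length v"
  defines "Q \<equiv> {..<M} \<times> {..<n}"
  assumes v: "list_all V v"
  shows "(\<Sum>\<tau>\<^sub>0\<in>perm_fams M n. \<Sum>a\<in>Pi\<^sub>E {..<M} (\<lambda>_. {..<n}). \<Sum>\<tau>\<in>perm_fams M n.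
      npscale (fam_sign M \<tau>\<^sub>0 * fam_sign M \<tau> * of_nat (card {\<pi>. \<pi> permutes Q \<and>
          (\<forall>q\<in>Q. (slot_row v q, slot_col v a \<tau> q) = (snd (\<pi> q), fam_app \<tau>\<^sub>0 (\<pi> q)))}))
        (npmon (reindex_word v a (\<lambda>t. \<tau> t (letter_col v t))))) \<in> traces (sum_list (map rdeg v))"
    (is "?X \<in> _")
proof -
  let ?F = "perm_fams M n"
  define K where "K = Pi\<^sub>E {..<M} (\<lambda>_. {..<n})"
  \<comment> \<open>The slots that keep their cofactor entry; each of them will receive a unit
    letter.\<close>
  define U where "U = {q \<in> Q. snd q \<noteq> letter_col v (fst q)}"
  \<comment> \<open>The row condition on \<open>\<pi>\<close> involves neither \<open>a\<close> nor
    the families, so the sum over these permutations can be moved outside.\<close>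
  define P where "P = {\<pi>. \<pi> permutes Q \<and> (\<forall>q\<in>Q. slot_row v q = snd (\<pi> q))}"
  have finQ: "finite Q" and finK: "finite K" unfolding Q_def K_def by (auto intro: finite_PiE)
  have finP: "finite P" unfolding P_def using finite_permutations[OF finQ] by (rule rev_finite_subset) auto
  have "finite U" using finQ by (simp add: U_def)
  then obtain us where us: "set us = U" "distinct us" using finite_distinct_list by blast
  have letter: "rvalid G n (v ! t)" if "t < M" for t
    using v that by (auto simp: list_all_length M_def)
  have col: "letter_col v t < n" if "t < M" for t
    using letter[OF that] by (auto simp: rvalid_def letter_col_def)
  have hom: "fst (snd (v ! t)) \<in> G (fst (v ! t))" if "t < M" for t
    using letter[OF that] by (auto simp: rvalid_def)
  have slot: "(t, letter_col v t) \<in> Q" if "t < M" for t using col[OF that] that by (simp add: Q_def)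
  have P_Q: "\<pi> q \<in> Q" if "\<pi> \<in> P" "q \<in> Q" for \<pi> q
    using that permutes_in_image[of \<pi> Q q] unfolding P_def by simp
  define slots where "slots = map (\<lambda>t. (t, letter_col v t)) [0..<M] @ us"
  have slots: "set slots = Q" "distinct slots"
    using slot us by (auto simp: slots_def U_def Q_def distinct_map inj_on_def)
  \<comment> \<open>Each slot labels the column of exactly one letter, and \<open>\<theta>\<close>
    supplies the row label.\<close>
  define letters where "letters \<theta> = map (\<lambda>t. (fst (v ! t), fst (snd (v ! t)), \<theta> (t, letter_col v t), (t, letter_col v t))) [0..<M] @
    map (\<lambda>q. (0, 1, \<theta> q, q)) us" for \<theta> :: "nat \<times> nat \<Rightarrow> nat \<times> nat"
  define f where "f \<pi> \<alpha> \<beta> = (npmon (reindex_word v (\<lambda>t. \<alpha> (\<pi> (t, letter_col v t))) (\<lambda>t. \<beta> (t, letter_col v t)) @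
    map (\<lambda>q. (0, 1, \<alpha> (\<pi> q), \<beta> q)) us) :: ('r rgen, 'k) ncpoly)"
    for \<pi> :: "nat \<times> nat \<Rightarrow> nat \<times> nat" and \<alpha> \<beta> :: "nat \<times> nat \<Rightarrow> nat"
  \<comment> \<open>For fixed families, polarization determines \<open>a\<close> from
    \<open>\<pi>\<close> and \<open>\<tau>\<^sub>0\<close>; on \<open>U\<close> it requires equal
    indices, and the unit letters in \<open>f\<close> express this.\<close>
  have step1: "(\<Sum>a\<in>K. npscale (of_nat (card {\<pi>. \<pi> permutes Q \<and>
        (\<forall>q\<in>Q. (slot_row v q, slot_col v a \<tau> q) = (snd (\<pi> q), fam_app \<tau>\<^sub>0 (\<pi> q)))}))
      (npmon (reindex_word v a (\<lambda>t. \<tau> t (letter_col v t))))) \<approx> (\<Sum>\<pi>\<in>P. f \<pi> (fam_app \<tau>\<^sub>0) (fam_app \<tau>))"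
    if \<tau>: "\<tau>\<^sub>0 \<in> ?F" "\<tau> \<in> ?F" for \<tau>\<^sub>0 \<tau>
  proof -
    let ?w = "\<lambda>a. npmon (reindex_word v a (\<lambda>t. \<tau> t (letter_col v t))) :: ('r rgen, 'k) ncpoly"
    have lt: "fam_app \<tau>\<^sub>0 q < n" "fam_app \<tau> q < n" if "q \<in> Q" for q
      using that \<tau> fam_app_less unfolding Q_def by blast+
    have "npscale (of_nat (card {\<pi>. \<pi> permutes Q \<and>
        (\<forall>q\<in>Q. (slot_row v q, slot_col v a \<tau> q) = (snd (\<pi> q), fam_app \<tau>\<^sub>0 (\<pi> q)))})) (?w a) =
      (\<Sum>\<pi>\<in>P. if \<forall>q\<in>Q. slot_col v a \<tau> q = fam_app \<tau>\<^sub>0 (\<pi> q) then ?w a else 0)" for a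
    proof -
      have "{\<pi>. \<pi> permutes Q \<and> (\<forall>q\<in>Q. (slot_row v q, slot_col v a \<tau> q) = (snd (\<pi> q), fam_app \<tau>\<^sub>0 (\<pi> q)))} =
          {\<pi>\<in>P. \<forall>q\<in>Q. slot_col v a \<tau> q = fam_app \<tau>\<^sub>0 (\<pi> q)}" by (auto simp: P_def)
      moreover have "of_nat (card {\<pi>\<in>P. \<forall>q\<in>Q. slot_col v a \<tau> q = fam_app \<tau>\<^sub>0 (\<pi> q)}) =
          (\<Sum>\<pi>\<in>P. if \<forall>q\<in>Q. slot_col v a \<tau> q = fam_app \<tau>\<^sub>0 (\<pi> q) then 1 else 0 :: 'k)"
        using finP by (simp add: sum.If_cases Int_def)
      ultimately show ?thesis by (simp only: np.scale_sum_left) (rule sum.cong; simp)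
    qed
    then have "(\<Sum>a\<in>K. npscale (of_nat (card {\<pi>. \<pi> permutes Q \<and>
          (\<forall>q\<in>Q. (slot_row v q, slot_col v a \<tau> q) = (snd (\<pi> q), fam_app \<tau>\<^sub>0 (\<pi> q)))})) (?w a)) =
        (\<Sum>a\<in>K. \<Sum>\<pi>\<in>P. if \<forall>q\<in>Q. slot_col v a \<tau> q = fam_app \<tau>\<^sub>0 (\<pi> q) then ?w a else 0)"
      by (simp only:)
    also have "\<dots> = (\<Sum>\<pi>\<in>P. \<Sum>a\<in>K. if \<forall>q\<in>Q. slot_col v a \<tau> q = fam_app \<tau>\<^sub>0 (\<pi> q) then ?w a else 0)"
      by (rule sum.swap)
    also have "\<dots> \<approx> (\<Sum>\<pi>\<in>P. f \<pi> (fam_app \<tau>\<^sub>0) (fam_app \<tau>))"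
    proof (intro equ_sum)
      fix \<pi> assume \<pi>: "\<pi> \<in> P"
      let ?C = "\<forall>q\<in>U. fam_app \<tau>\<^sub>0 (\<pi> q) = fam_app \<tau> q"
      let ?a = "\<lambda>t. fam_app \<tau>\<^sub>0 (\<pi> (t, letter_col v t))"
      have a_lt: "?a t < n" if "t < M" for t using lt(1)[OF P_Q[OF \<pi> slot[OF that]]] .
      have cond: "(\<forall>q\<in>Q. slot_col v a \<tau> q = fam_app \<tau>\<^sub>0 (\<pi> q)) \<longleftrightarrow> (\<forall>t\<in>{..<M}. a t = ?a t) \<and> ?C" for a
      proof
        assume *: "\<forall>q\<in>Q. slot_col v a \<tau> q = fam_app \<tau>\<^sub>0 (\<pi> q)"
        have "a t = ?a t" if "t < M" for t using bspec[OF * slot[OF that]] by (simp add: slot_col_def)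
        moreover have ?C using * by (auto simp: U_def slot_col_def)
        ultimately show "(\<forall>t\<in>{..<M}. a t = ?a t) \<and> ?C" by blast
      next
        assume *: "(\<forall>t\<in>{..<M}. a t = ?a t) \<and> ?C"
        show "\<forall>q\<in>Q. slot_col v a \<tau> q = fam_app \<tau>\<^sub>0 (\<pi> q)"
        proof
          fix q assume q: "q \<in> Q"
          show "slot_col v a \<tau> q = fam_app \<tau>\<^sub>0 (\<pi> q)"
          proof (cases "snd q = letter_col v (fst q)")
            case True
            then have "(fst q, letter_col v (fst q)) = q" by (metis prod.collapse)
            moreover have "fst q < M" using q by (auto simp: Q_def)
            ultimately show ?thesis using * True by (simp add: slot_col_def)
          next
            case False
            with q have "q \<in> U" by (simp add: U_def)
            with * have "fam_app \<tau>\<^sub>0 (\<pi> q) = fam_app \<tau> q" by blast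
            with False show ?thesis by (simp add: slot_col_def)
          qed
        qed
      qed
      have "(\<Sum>a\<in>K. if \<forall>q\<in>Q. slot_col v a \<tau> q = fam_app \<tau>\<^sub>0 (\<pi> q) then ?w a else 0) =
          (\<Sum>a\<in>K. if \<forall>t\<in>{..<M}. a t = ?a t then if ?C then ?w a else 0 else 0)"
        unfolding cond by (intro sum.cong refl) auto
      also have "\<dots> = (if ?C then ?w (restrict ?a {..<M}) else 0)"
        unfolding K_def by (rule sum_PiE_delta) (use a_lt in auto)
      also have "?w (restrict ?a {..<M}) = npmon (reindex_word v ?a (\<lambda>t. fam_app \<tau> (t, letter_col v t)))"
        by (intro arg_cong[of _ _ npmon]) (simp add: reindex_word_def M_def fam_app_def)
      also have "(if ?C then npmon (reindex_word v ?a (\<lambda>t. fam_app \<tau> (t, letter_col v t))) else 0) \<approx>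
          f \<pi> (fam_app \<tau>\<^sub>0) (fam_app \<tau>)"
      proof -
        have "list_all V (reindex_word v ?a (\<lambda>t. fam_app \<tau> (t, letter_col v t)))"
          using hom a_lt lt(2)[OF slot] by (auto simp: reindex_word_def list_all_iff rvalid_def M_def)
        moreover have "fam_app \<tau>\<^sub>0 (\<pi> q) < n \<and> fam_app \<tau> q < n" if "q \<in> set us" for q
          using lt P_Q[OF \<pi>] that by (auto simp: us(1) U_def)
        ultimately show ?thesis unfolding f_def us(1)[symmetric] by (rule equ_sym[OF equ_unit_letters])
      qed
      finally show "(\<Sum>a\<in>K. if \<forall>q\<in>Q. slot_col v a \<tau> q = fam_app \<tau>\<^sub>0 (\<pi> q) then ?w a else 0) \<approx>
          f \<pi> (fam_app \<tau>\<^sub>0) (fam_app \<tau>)" .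
    qed
    finally show ?thesis .
  qed
  have contract: "(\<Sum>\<beta>\<in>Pi\<^sub>E Q (\<lambda>_. {..<n}). f \<pi> (\<lambda>q. \<beta> (fst q, fam_app \<sigma> q)) \<beta>) \<in> traces (sum_list (map rdeg v))"
    if \<pi>: "\<pi> \<in> P" and \<sigma>: "\<sigma> \<in> ?F" for \<pi> \<sigma>
  proof -
    \<comment> \<open>In \<open>f\<close> the row index at slot \<open>q\<close> is read at
      \<open>\<pi> q\<close>, and the alternating identity has replaced it by the value of
      \<open>\<beta>\<close> at this slot. As \<open>\<theta>\<close> permutes \<open>Q\<close>,
      every label occurs once on each side.\<close>
    define \<theta> where "\<theta> = (\<lambda>q. (fst (\<pi> q), fam_app \<sigma> (\<pi> q)))"
    have "inj_on (\<lambda>q. (fst q, fam_app \<sigma> q)) Q"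
    proof (rule inj_onI)
      fix q q' assume q: "q \<in> Q" "q' \<in> Q" and eq: "(fst q, fam_app \<sigma> q) = (fst q', fam_app \<sigma> q')"
      have "inj (\<sigma> (fst q))" using q by (intro permutes_inj[OF perm_famsD[OF \<sigma>]]) (auto simp: Q_def)
      then show "q = q'" using eq by (auto simp: fam_app_def prod_eq_iff inj_eq)
    qed
    moreover have "\<pi> permutes Q" using \<pi> by (simp add: P_def)
    ultimately have inj: "inj_on \<theta> Q"
      using comp_inj_on[of \<pi> Q "\<lambda>q. (fst q, fam_app \<sigma> q)"]
      by (simp add: \<theta>_def comp_def permutes_inj_on permutes_image)
    have "\<theta> ` Q \<subseteq> Q"
      using P_Q[OF \<pi>] fam_app_less[OF \<sigma>] by (force simp: \<theta>_def Q_def)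
    then have img: "\<theta> ` Q = Q" using inj by (rule endo_inj_surj[OF finQ])
    have lab1: "map lab1 (letters \<theta>) = map \<theta> slots" and lab2: "map lab2 (letters \<theta>) = slots"
      by (simp_all add: letters_def slots_def comp_def)
    have "(\<Sum>\<beta>\<in>Pi\<^sub>E Q (\<lambda>_. {..<n}). npmon (inst \<beta> (letters \<theta>))) \<in> traces (sum_list (map fst (letters \<theta>)))"
    proof (rule contraction_in_traces)
      show "fst (snd x) \<in> G (fst x)" if "x \<in> set (letters \<theta>)" for x
        using that hom one_homogeneous by (auto simp: letters_def)
      show "distinct (map lab1 (letters \<theta>))" using inj slots by (simp add: lab1 distinct_map)
      show "distinct (map lab2 (letters \<theta>))" using slots by (simp add: lab2)
      have "lab1 ` set (letters \<theta>) = set (map lab1 (letters \<theta>))" by simp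
      also have "\<dots> = Q" unfolding lab1 using slots img by simp
      finally show "Q = lab1 ` set (letters \<theta>)" ..
      have "lab2 ` set (letters \<theta>) = set (map lab2 (letters \<theta>))" by simp
      also have "\<dots> = Q" unfolding lab2 using slots by simp
      finally show "Q = lab2 ` set (letters \<theta>)" ..
    qed
    moreover have "npmon (inst \<beta> (letters \<theta>)) = f \<pi> (\<lambda>q. \<beta> (fst q, fam_app \<sigma> q)) \<beta>" for \<beta>
      by (simp add: f_def letters_def inst_def reindex_word_def M_def \<theta>_def comp_def)
    moreover have "sum_list (map fst (letters \<theta>)) = sum_list (map rdeg v)"
    proof -
      have "map fst (letters \<theta>) = map (\<lambda>t. rdeg (v ! t)) [0..<length v] @ map (\<lambda>_. 0) us"
        by (simp add: letters_def comp_def rdeg_def M_def)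
      also have "map (\<lambda>t. rdeg (v ! t)) [0..<length v] = map rdeg (map ((!) v) [0..<length v])"
        by (simp only: map_map comp_def)
      also have "\<dots> = map rdeg v" by (simp only: map_nth)
      finally show ?thesis by (simp add: sum_list_triv)
    qed
    ultimately show ?thesis by (simp only:)
  qed
  have "?X = (\<Sum>\<tau>\<^sub>0\<in>?F. \<Sum>\<tau>\<in>?F. npscale (fam_sign M \<tau>\<^sub>0 * fam_sign M \<tau>)
      (\<Sum>a\<in>K. npscale (of_nat (card {\<pi>. \<pi> permutes Q \<and>
          (\<forall>q\<in>Q. (slot_row v q, slot_col v a \<tau> q) = (snd (\<pi> q), fam_app \<tau>\<^sub>0 (\<pi> q)))}))
        (npmon (reindex_word v a (\<lambda>t. \<tau> t (letter_col v t))))))"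
    unfolding K_def np.scale_sum_right np.scale_scale by (rule sum.cong[OF refl sum.swap])
  also have "\<dots> \<approx> (\<Sum>\<tau>\<^sub>0\<in>?F. \<Sum>\<tau>\<in>?F. npscale (fam_sign M \<tau>\<^sub>0 * fam_sign M \<tau>)
      (\<Sum>\<pi>\<in>P. f \<pi> (fam_app \<tau>\<^sub>0) (fam_app \<tau>)))"
    by (intro equ_sum equ_scale step1)
  also have "\<dots> = (\<Sum>\<pi>\<in>P. \<Sum>\<tau>\<^sub>0\<in>?F. \<Sum>\<tau>\<in>?F. npscale (fam_sign M \<tau>\<^sub>0 * fam_sign M \<tau>) (f \<pi> (fam_app \<tau>\<^sub>0) (fam_app \<tau>)))"
    unfolding np.scale_sum_right
    by (subst (2) sum.swap, subst sum.swap, rule sum.cong[OF refl], rule sum.cong[OF refl], rule refl)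
  also have "\<dots> = (\<Sum>\<pi>\<in>P. \<Sum>\<sigma>\<in>?F. npscale (fam_sign M \<sigma>)
      (\<Sum>\<beta>\<in>Pi\<^sub>E Q (\<lambda>_. {..<n}). f \<pi> (\<lambda>q. \<beta> (fst q, fam_app \<sigma> q)) \<beta>))"
  \<comment> \<open>The alternating identity is one between scalars, so it is applied to the
    coefficient of each word \<open>w\<close>.\<close>
  proof (rule sum.cong[OF refl], rule ext)
    fix \<pi> w assume \<pi>: "\<pi> \<in> P"
    have "f \<pi> \<alpha> \<beta> w = f \<pi> \<alpha>' \<beta>' w"
      if "\<And>q. q \<in> Q \<Longrightarrow> \<alpha> q = \<alpha>' q" "\<And>q. q \<in> Q \<Longrightarrow> \<beta> q = \<beta>' q" for \<alpha> \<alpha>' \<beta> \<beta>'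
    proof -
      have 1: "\<alpha> (\<pi> (t, letter_col v t)) = \<alpha>' (\<pi> (t, letter_col v t))"
        "\<beta> (t, letter_col v t) = \<beta>' (t, letter_col v t)" if "t < M" for t
        using slot[OF that] by (auto intro: \<open>\<And>q. q \<in> Q \<Longrightarrow> \<alpha> q = \<alpha>' q\<close> \<open>\<And>q. q \<in> Q \<Longrightarrow> \<beta> q = \<beta>' q\<close> P_Q[OF \<pi>])
      have 2: "\<alpha> (\<pi> q) = \<alpha>' (\<pi> q)" "\<beta> q = \<beta>' q" if "q \<in> set us" for q
      proof -
        have "q \<in> Q" using that by (simp add: us(1) U_def)
        then show "\<alpha> (\<pi> q) = \<alpha>' (\<pi> q)" "\<beta> q = \<beta>' q"
          by (auto intro: \<open>\<And>q. q \<in> Q \<Longrightarrow> \<alpha> q = \<alpha>' q\<close> \<open>\<And>q. q \<in> Q \<Longrightarrow> \<beta> q = \<beta>' q\<close> P_Q[OF \<pi>])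
      qed
      have "f \<pi> \<alpha> \<beta> = f \<pi> \<alpha>' \<beta>'"
        unfolding f_def reindex_word_def M_def[symmetric]
        by (rule arg_cong[of _ _ npmon], rule arg_cong2[of _ _ _ _ "(@)"]; rule map_cong[OF refl])
          (simp_all add: 1 2)
      then show ?thesis by simp
    qed
    then have eq: "(\<Sum>\<tau>\<^sub>0\<in>?F. \<Sum>\<tau>\<in>?F. fam_sign M \<tau>\<^sub>0 * fam_sign M \<tau> * f \<pi> (fam_app \<tau>\<^sub>0) (fam_app \<tau>) w) =
        (\<Sum>\<sigma>\<in>?F. fam_sign M \<sigma> * (\<Sum>\<beta>\<in>Pi\<^sub>E Q (\<lambda>_. {..<n}). f \<pi> (\<lambda>q. \<beta> (fst q, fam_app \<sigma> q)) \<beta> w))"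
      unfolding Q_def by (rule double_alternating_sum[of M n "\<lambda>\<alpha> \<beta>. f \<pi> \<alpha> \<beta> w"])
    show "(\<Sum>\<tau>\<^sub>0\<in>?F. \<Sum>\<tau>\<in>?F. npscale (fam_sign M \<tau>\<^sub>0 * fam_sign M \<tau>) (f \<pi> (fam_app \<tau>\<^sub>0) (fam_app \<tau>))) w =
        (\<Sum>\<sigma>\<in>?F. npscale (fam_sign M \<sigma>)
          (\<Sum>\<beta>\<in>Pi\<^sub>E Q (\<lambda>_. {..<n}). f \<pi> (\<lambda>q. \<beta> (fst q, fam_app \<sigma> q)) \<beta>)) w"
      unfolding sum_fun_apply npscale_def by (rule eq)
  qed
  finally have "?X \<approx> (\<Sum>\<pi>\<in>P. \<Sum>\<sigma>\<in>?F. npscale (fam_sign M \<sigma>)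
      (\<Sum>\<beta>\<in>Pi\<^sub>E Q (\<lambda>_. {..<n}). f \<pi> (\<lambda>q. \<beta> (fst q, fam_app \<sigma> q)) \<beta>))" .
  moreover have "(\<Sum>\<pi>\<in>P. \<Sum>\<sigma>\<in>?F. npscale (fam_sign M \<sigma>)
      (\<Sum>\<beta>\<in>Pi\<^sub>E Q (\<lambda>_. {..<n}). f \<pi> (\<lambda>q. \<beta> (fst q, fam_app \<sigma> q)) \<beta>)) \<in> traces (sum_list (map rdeg v))"
    by (rule np.subspace_sum[OF traces_subspace], rule np.subspace_sum[OF traces_subspace],
        rule np.subspace_scale[OF traces_subspace], rule contract)
  ultimately show ?thesis by (rule traces_cong)
qed

theorem invariant_in_traces:
  assumes n: "0 < n" and p: "p \<in> npPol V" and homog: "nphomog m p"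
    and inv: "\<And>g h. inv_pair n g h \<Longrightarrow> npsubst (glact n g h) p \<approx> p"
  shows "p \<in> traces m"
proof -
  define supp where "supp = {u. p u \<noteq> 0}"
  have fin: "finite supp" using p by (simp add: npPol_def supp_def)
  \<comment> \<open>The successor leaves room for at least one unit letter in every word, as
    singular matrices require; inserting 0 covers the empty support.\<close>
  define M where "M = Suc (Max (insert 0 (length ` supp)))"
  have M: "length u < M" if "p u \<noteq> 0" for u
    using that fin unfolding M_def less_Suc_eq_le by (intro Max_ge) (auto simp: supp_def)
  define pad where "pad u = u @ replicate (M - length u) (0, 1, 0, 0)" for u :: "'r rgen list"
  define Q where "Q = {..<M} \<times> {..<n}"
  define K where "K = Pi\<^sub>E {..<M} (\<lambda>_. {..<n})"
  let ?F = "perm_fams M n"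
  have pad_length: "length (pad u) = M" if "u \<in> supp" for u
    using M[of u] that by (simp add: pad_def supp_def)
  have pad_valid: "list_all V (pad u)" if "u \<in> supp" for u
    using that p n one_homogeneous by (auto simp: pad_def supp_def npPol_def list_all_iff rvalid_def)
  have pad_deg: "sum_list (map rdeg (pad u)) = m" if "u \<in> supp" for u
    using that homog by (simp add: pad_def supp_def nphomog_def sum_list_replicate rdeg_def)
  let ?A = "supp \<times> K \<times> ?F"
  \<comment> \<open>Both sides are brought to the form compared by \<open>equ_polarize\<close>: a
    finite sum with one entry of \<open>g\<close> per slot in each term.\<close>
  have F: "(\<Sum>z\<in>?A. npscale (p (fst z) * fam_sign M (snd (snd z)) *
        (\<Prod>q\<in>Q. g (slot_row (pad (fst z)) q) (slot_col (pad (fst z)) (fst (snd z)) (snd (snd z)) q)))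
      (npmon (reindex_word (pad (fst z)) (fst (snd z)) (\<lambda>t. snd (snd z) t (letter_col (pad (fst z)) t))))) \<approx>
    (\<Sum>\<tau>\<in>?F. npscale (fam_sign M \<tau> * (\<Prod>q\<in>Q. g (snd q) (fam_app \<tau> q))) p)" for g
  proof -
    have "(\<Sum>z\<in>?A. npscale (p (fst z) * fam_sign M (snd (snd z)) *
          (\<Prod>q\<in>Q. g (slot_row (pad (fst z)) q) (slot_col (pad (fst z)) (fst (snd z)) (snd (snd z)) q)))
        (npmon (reindex_word (pad (fst z)) (fst (snd z)) (\<lambda>t. snd (snd z) t (letter_col (pad (fst z)) t))))) =
        (\<Sum>u\<in>supp. npscale (p u) (npprod (map (glact n g (nadj n g)) (pad u))))"
      unfolding sum.cartesian_product' fst_conv snd_conv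
      by (intro sum.cong refl)
        (simp only: npprod_glact_nadj[OF pad_valid pad_length] np.scale_sum_right np.scale_scale Q_def K_def mult.assoc)
    also have "\<dots> \<approx> npscale (ndet n g ^ M) p"
      unfolding supp_def pad_def by (rule invariance_all_matrices[OF n p inv M])
    also have "\<dots> = (\<Sum>\<tau>\<in>?F. npscale (fam_sign M \<tau> * (\<Prod>q\<in>Q. g (snd q) (fam_app \<tau> q))) p)"
      by (simp only: ndet_power np.scale_sum_left Q_def)
    finally show ?thesis .
  qed
  define N where "N u a \<tau> \<tau>\<^sub>0 = card {\<pi>. \<pi> permutes Q \<and>
    (\<forall>q\<in>Q. (slot_row (pad u) q, slot_col (pad u) a \<tau> q) = (snd (\<pi> q), fam_app \<tau>\<^sub>0 (\<pi> q)))}" for u a \<tau> \<tau>\<^sub>0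
  define N' where "N' \<tau> \<tau>\<^sub>0 = card {\<pi>. \<pi> permutes Q \<and>
    (\<forall>q\<in>Q. (snd q, fam_app \<tau> q) = (snd (\<pi> q), fam_app \<tau>\<^sub>0 (\<pi> q)))}" for \<tau> \<tau>\<^sub>0
  define W where "W u a \<tau> = (npmon (reindex_word (pad u) a (\<lambda>t. \<tau> t (letter_col (pad u) t))) :: ('r rgen, 'k) ncpoly)" for u a \<tau>
  have finQ: "finite Q" by (simp add: Q_def)
  have pol: "(\<Sum>u\<in>supp. \<Sum>a\<in>K. \<Sum>\<tau>\<in>?F. npscale (p u * fam_sign M \<tau> * of_nat (N u a \<tau> \<tau>\<^sub>0)) (W u a \<tau>)) \<approx>
      (\<Sum>\<tau>\<in>?F. npscale (fam_sign M \<tau> * of_nat (N' \<tau> \<tau>\<^sub>0)) p)" for \<tau>\<^sub>0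
    using equ_polarize[OF finQ, where A = ?A and B = ?F
        and c = "\<lambda>z. p (fst z) * fam_sign M (snd (snd z))"
        and y = "\<lambda>z q. (slot_row (pad (fst z)) q, slot_col (pad (fst z)) (fst (snd z)) (snd (snd z)) q)"
        and v = "\<lambda>z. npmon (reindex_word (pad (fst z)) (fst (snd z)) (\<lambda>t. snd (snd z) t (letter_col (pad (fst z)) t)))"
        and d = "fam_sign M" and z = "\<lambda>\<tau> q. (snd q, fam_app \<tau> q)" and w = "\<lambda>_. p"
        and ?y0.0 = "\<lambda>q. (snd q, fam_app \<tau>\<^sub>0 q)", unfolded fst_conv snd_conv, OF F]
    unfolding sum.cartesian_product' fst_conv snd_conv N_def N'_def W_def .
  \<comment> \<open>Contraction: the polarized identities are weighted with the signs of
    \<open>\<tau>\<^sub>0\<close>, the coefficients of det^M, and added up.\<close>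
  have "npscale (fam_coeff M n) p =
      (\<Sum>\<tau>\<^sub>0\<in>?F. npscale (fam_sign M \<tau>\<^sub>0) (\<Sum>\<tau>\<in>?F. npscale (fam_sign M \<tau> * of_nat (N' \<tau> \<tau>\<^sub>0)) p))"
    unfolding fam_coeff_def N'_def Q_def by (simp only: np.scale_sum_left np.scale_sum_right np.scale_scale mult.assoc)
  also have "\<dots> \<approx> (\<Sum>\<tau>\<^sub>0\<in>?F. npscale (fam_sign M \<tau>\<^sub>0)
      (\<Sum>u\<in>supp. \<Sum>a\<in>K. \<Sum>\<tau>\<in>?F. npscale (p u * fam_sign M \<tau> * of_nat (N u a \<tau> \<tau>\<^sub>0)) (W u a \<tau>)))"
    by (intro equ_sum equ_scale equ_sym[OF pol])
  also have "\<dots> = (\<Sum>u\<in>supp. npscale (p u) (\<Sum>\<tau>\<^sub>0\<in>?F. \<Sum>a\<in>K. \<Sum>\<tau>\<in>?F.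
      npscale (fam_sign M \<tau>\<^sub>0 * fam_sign M \<tau> * of_nat (N u a \<tau> \<tau>\<^sub>0)) (W u a \<tau>)))"
    unfolding np.scale_sum_right np.scale_scale
    by (subst sum.swap) (simp only: mult_ac)
  finally have "npscale (fam_coeff M n) p \<approx> \<dots>" .
  moreover have "(\<Sum>u\<in>supp. npscale (p u) (\<Sum>\<tau>\<^sub>0\<in>?F. \<Sum>a\<in>K. \<Sum>\<tau>\<in>?F.
      npscale (fam_sign M \<tau>\<^sub>0 * fam_sign M \<tau> * of_nat (N u a \<tau> \<tau>\<^sub>0)) (W u a \<tau>))) \<in> traces m"
  proof (rule np.subspace_sum[OF traces_subspace], rule np.subspace_scale[OF traces_subspace])
    fix u assume u: "u \<in> supp"
    show "(\<Sum>\<tau>\<^sub>0\<in>?F. \<Sum>a\<in>K. \<Sum>\<tau>\<in>?F.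
        npscale (fam_sign M \<tau>\<^sub>0 * fam_sign M \<tau> * of_nat (N u a \<tau> \<tau>\<^sub>0)) (W u a \<tau>)) \<in> traces m"
      using polarized_word_in_traces[OF pad_valid[OF u]]
      unfolding pad_length[OF u] pad_deg[OF u] N_def W_def K_def Q_def .
  qed
  ultimately have "npscale (fam_coeff M n) p \<in> traces m" by (rule traces_cong)
  then have "npscale (inverse (fam_coeff M n)) (npscale (fam_coeff M n) p) \<in> traces m"
    by (rule np.subspace_scale[OF traces_subspace])
  then show ?thesis by (simp add: fam_coeff_nonzero)
qed

end

text \<open>Elements of R_n are handled through representatives: an invariant of degree
  \<open>m\<close> is a homogeneous \<open>p\<close> fixed modulo the relations, and a congruent
  \<open>q\<close> in \<open>trace_span\<close> is a preimage written as a polynomial in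
  traces.\<close>

theorem mainTheorem1:
  fixes smul :: "'k::field_char_0 \<Rightarrow> 'r::ring_1 \<Rightarrow> 'r"
    and G :: "int \<Rightarrow> 'r set" and d :: "'r \<Rightarrow> 'r"
    and n :: nat and m :: int and p :: "('r rgen, 'k) ncpoly"
  assumes "is_dga smul G d"
    and "n \<ge> 1"
    and "p \<in> npPol (rvalid G n)"
    and "nphomog m p"
    and "\<forall>g h. inv_pair n g h \<longrightarrow> npsub (npsubst (glact n g h) p) p \<in> Rn_ideal smul G n"
  shows "\<exists>q \<in> trace_span G n m. npsub p q \<in> Rn_ideal smul G n"
proof -
  have one: "1 \<in> G 0" using assms(1) unfolding is_dga_def by (elim conjE)
  have mult: "\<forall>i j. \<forall>x\<in>G i. \<forall>y\<in>G j. x * y \<in> G (i + j)"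
    using assms(1) unfolding is_dga_def by (elim conjE)
  interpret graded_rep smul G n by unfold_locales (use one mult in auto)
  have "p \<in> traces m"
    using assms by (intro invariant_in_traces) (auto simp: equ_def np_eqs)
  then show ?thesis by (simp add: traces_def equ_def np_eqs)
qed

end
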